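(* Let $p$ be a prime and let $G$ be a finite abelian $p$-group with $\exp(G)=q$ and $\left\lceil \frac{D(G)}{q}\right\rceil = d$. If $p\ge 2d-2+\left\lceil \frac{2D(G)-2}{q}\right\rceil$, then $\ell(G)\le p+d$. That is, $s_{kq}(G)=kq+D(G)-1$ for every integer $k\ge p+d$.
   Context: $\exp(G)$ is the exponent of the finite abelian group $G$ (written additively), i.e. the largest order of an element of $G$. A sequence over $G$ is a finite sequence of elements of $G$, repetitions allowed, order irrelevant (a finite multiset); its length is the number of terms counted with multiplicity; a subsequence is a sub-multiset; a sequence is zero-sum if the sum of its terms is $0$. $D(G)$ is the Davenport constant of $G$: the smallest positive integer $\ell$ such that every sequence over $G$ of length $\ell$ has a nonempty zero-sum subsequence. For a positive integer $k$, $s_k(G)$ is the smallest positive integer $\ell$ such that every sequence over $G$ of length at least $\ell$ has a zero-sum subsequence of length exactly $k$ ($s_k(G)=\infty$ if no such $\ell$ exists). For a finite abelian group $G$ with $\exp(G)=n$, $\ell(G)$ is the smallest positive integer $\ell$ such that $s_{kn}(G)=kn+D(G)-1$ for every integer $k\ge \ell$. *)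

theory Defs
  imports
    Complex_Main
    "HOL-Algebra.Multiplicative_Group"
    "HOL-Computational_Algebra.Primes"
    "HOL-Library.Multiset"
    "HOL-Library.Extended_Nat"
begin

text \<open>
  Finite abelian groups are commutative groups in the sense of HOL-Algebra, hence written
  multiplicatively: the sum of a sequence becomes a product, and zero-sum means that this
  product is \<open>\<one>\<close>. A sequence over \<open>G\<close> is a finite multiset of elements of \<open>carrier G\<close>.
\<close>

definition group_exp :: "('a, 'b) monoid_scheme \<Rightarrow> nat" where
  "group_exp G = Max (group.ord G ` carrier G)"

definition seq_over :: "('a, 'b) monoid_scheme \<Rightarrow> 'a multiset \<Rightarrow> bool" where
  "seq_over G S \<longleftrightarrow> set_mset S \<subseteq> carrier G"

text \<open>Repeated terms are collected into one power per distinct element.\<close>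

definition seq_sum :: "('a, 'b) monoid_scheme \<Rightarrow> 'a multiset \<Rightarrow> 'a" where
  "seq_sum G S = (\<Otimes>\<^bsub>G\<^esub>x\<in>set_mset S. x [^]\<^bsub>G\<^esub> count S x)"

definition zero_sum :: "('a, 'b) monoid_scheme \<Rightarrow> 'a multiset \<Rightarrow> bool" where
  "zero_sum G S \<longleftrightarrow> seq_sum G S = \<one>\<^bsub>G\<^esub>"

text \<open>For finite \<open>G\<close> the least element below exists (\<open>order G\<close> is an admissible length).\<close>

definition davenport :: "('a, 'b) monoid_scheme \<Rightarrow> nat" where
  "davenport G = (LEAST l. 0 < l \<and>
     (\<forall>S. seq_over G S \<and> size S = l \<longrightarrow> (\<exists>T. T \<subseteq># S \<and> T \<noteq> {#} \<and> zero_sum G T)))"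

text \<open>
  The infimum in \<open>enat\<close> is the least element of a nonempty set and \<open>\<infinity>\<close> for the empty set.
\<close>

definition s_const :: "nat \<Rightarrow> ('a, 'b) monoid_scheme \<Rightarrow> enat" where
  "s_const k G = Inf {enat l | l. 0 < l \<and>
     (\<forall>S. seq_over G S \<and> l \<le> size S \<longrightarrow> (\<exists>T. T \<subseteq># S \<and> size T = k \<and> zero_sum G T))}"

definition ell :: "('a, 'b) monoid_scheme \<Rightarrow> enat" where
  "ell G = Inf {enat l | l. 0 < l \<and>
     (\<forall>k\<ge>l. s_const (k * group_exp G) G = enat (k * group_exp G + davenport G - 1))}"

end

theory Submission
  imports Defs "HOL-Library.Poly_Mapping" "HOL-Number_Theory.Cong"
begin

text \<open>
  By Olson's theorem, for a \<open>p\<close>-group with \<open>D = D(G)\<close> a product of \<open>D\<close> factors \<open>1 - g\<close> vanishes in the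
  group ring over the field with \<open>p\<close> elements. Equivalently, the number of zero-sum subsequences
  of a sequence of length \<open>n\<close>, counted with sign and weighted by an integer-valued polynomial of
  degree at most \<open>n - D\<close> in the length, is divisible by \<open>p\<close>. Taking as weight the indicator of
  the multiples of \<open>q\<close> times \<open>\<Prod>b\<in>B. (m choose q) - b\<close>, where \<open>(nq choose q) \<equiv> n\<close> modulo \<open>p\<close>, shows:
  a sequence of length at least \<open>D + q - 1 + |B| q\<close> has a nonempty zero-sum subsequence of some
  length \<open>nq\<close> with \<open>n\<close> modulo \<open>p\<close> outside \<open>B\<close>.

  Let \<open>S\<close> have length \<open>(p + t) q + D - 1\<close> with \<open>d \<le> t < 2 d\<close> and no zero-sum subsequence of length
  \<open>(p + t) q\<close>. Avoiding \<open>1, \<dots>, p - 1\<close> gives a zero-sum \<open>T\<close> of length \<open>p q\<close>; let \<open>R\<close> be the rest of \<open>S\<close>.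
  Also \<open>S\<close> has no zero-sum subsequence of length \<open>t q\<close>, since the rest would contain one of length \<open>p q\<close>.
  At least \<open>t\<close> values \<open>n\<close> occur as zero-sum lengths \<open>n q\<close> in \<open>R\<close>, and each of the values \<open>|t - n|\<close>
  is missing in \<open>T\<close>; so at least \<open>t / 2\<close> values below \<open>t\<close> are missing in \<open>T\<close>, and by complements as
  many above \<open>p - t\<close>. But at most \<open>d - 1\<close> values are missing in \<open>T\<close>. Larger \<open>k\<close> reduce to this
  case by removing zero-sum subsequences of length at most \<open>d q\<close>.
\<close>

subsection \<open>Ideals of commutative rings\<close>

text \<open>No quotient ring is formed: a congruence modulo the ideal is stated as membership of a
  difference.\<close>

locale ring_ideal =
  fixes K :: "'r::comm_ring_1 set"
  assumes add_mem: "x \<in> K \<Longrightarrow> y \<in> K \<Longrightarrow> x + y \<in> K"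
    and mult_mem: "x \<in> K \<Longrightarrow> r * x \<in> K"
    and zero_mem: "0 \<in> K"
begin

lemma uminus_mem: "x \<in> K \<Longrightarrow> - x \<in> K"
  using mult_mem[of x "-1"] by simp

lemma diff_mem: "x \<in> K \<Longrightarrow> y \<in> K \<Longrightarrow> x - y \<in> K"
  using add_mem[of x "- y"] uminus_mem by simp

lemma mult_mem_right: "x \<in> K \<Longrightarrow> x * r \<in> K"
  using mult_mem[of x r] by (simp add: mult.commute)

lemma sum_mem: "(\<And>i. i \<in> I \<Longrightarrow> f i \<in> K) \<Longrightarrow> sum f I \<in> K"
  by (induction I rule: infinite_finite_induct) (auto intro: add_mem zero_mem)

lemma sum_mset_mem: "(\<And>i. i \<in># M \<Longrightarrow> f i \<in> K) \<Longrightarrow> (\<Sum>i\<in>#M. f i) \<in> K"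
  by (induction M) (auto intro: add_mem zero_mem)

lemma of_nat_mem: "of_nat p \<in> K \<Longrightarrow> p dvd n \<Longrightarrow> of_nat n \<in> K"
  by (metis dvdE of_nat_mult mult_mem_right)

lemma prod_mset_diff_mem:
  assumes "\<And>g. g \<in># M \<Longrightarrow> f g - h g \<in> K"
  shows "(\<Prod>g\<in>#M. f g) - (\<Prod>g\<in>#M. h g) \<in> K"
  using assms
proof (induction M)
  case empty
  then show ?case by (simp add: zero_mem)
next
  case (add x M)
  let ?F = "\<Prod>g\<in>#M. f g" and ?H = "\<Prod>g\<in>#M. h g"
  \<comment> \<open>Telescoping: this expression equals \<open>f x * ?F - h x * ?H\<close>.\<close>
  have "f x * (?F - ?H) + ?H * (f x - h x) \<in> K"
    using add by (intro add_mem mult_mem) auto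
  then show ?case by (simp add: algebra_simps)
qed

text \<open>Every term of the expansion beyond the linear ones has two factors
  \<open>u g * u h\<close>, which lie in the ideal. This is what later turns products into
  sums.\<close>

lemma prod_mset_one_minus:
  assumes "\<And>g h. g \<in># M \<Longrightarrow> h \<in># M \<Longrightarrow> u g * u h \<in> K"
  shows "(\<Prod>g\<in>#M. 1 - u g) - (1 - (\<Sum>g\<in>#M. u g)) \<in> K"
  using assms
proof (induction M)
  case empty
  then show ?case by (simp add: zero_mem)
next
  case (add x M)
  let ?P = "\<Prod>g\<in>#M. 1 - u g" and ?S = "\<Sum>g\<in>#M. u g"
  have "?P - (1 - ?S) \<in> K" using add by auto
  then have "(1 - u x) * (?P - (1 - ?S)) \<in> K" by (rule mult_mem)
  moreover have "(\<Sum>g\<in>#M. u x * u g) \<in> K"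
    by (rule sum_mset_mem) (use add.prems in auto)
  ultimately have "(1 - u x) * (?P - (1 - ?S)) + u x * ?S \<in> K"
    by (simp add: add_mem sum_mset_distrib_left)
  moreover have "(1 - u x) * (?P - (1 - ?S)) + u x * ?S
      = (\<Prod>g\<in>#add_mset x M. 1 - u g) - (1 - (\<Sum>g\<in>#add_mset x M. u g))"
    by (simp add: algebra_simps)
  ultimately show ?case by simp
qed

end

section \<open>The Frobenius identity and powers of p in multiplicities\<close>

lemma prime_dvd_prime_power_choose:
  fixes p :: nat
  assumes "prime p" "0 < i" "i < p ^ e"
  shows "p dvd (p ^ e choose i)"
proof (rule ccontr)
  assume "\<not> p dvd (p ^ e choose i)"
  then have "coprime (p ^ e) (p ^ e choose i)"
    using assms(1) by (simp add: prime_imp_coprime)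
  moreover have "p ^ e dvd i * (p ^ e choose i)"
    using times_binomial_minus1_eq[of i "p ^ e"] assms(2) by simp
  ultimately have "p ^ e dvd i"
    by (simp add: coprime_dvd_mult_left_iff)
  then show False using assms by (auto dest: dvd_imp_le)
qed

text \<open>All mixed terms of the binomial expansion have coefficients divisible by p.\<close>

lemma (in ring_ideal) prime_power_add:
  assumes "prime p" "of_nat p \<in> K"
  shows "(x + y) ^ (p ^ a) - (x ^ (p ^ a) + y ^ (p ^ a)) \<in> K"
proof -
  let ?q = "p ^ a"
  let ?t = "\<lambda>k. of_nat (?q choose k) * x ^ k * y ^ (?q - k)"
  have q: "?q > 0" using assms(1) by (simp add: prime_gt_0_nat)
  have "{..?q} = insert 0 (insert ?q {0<..<?q})" using q by auto
  then have "(x + y) ^ ?q = x ^ ?q + y ^ ?q + sum ?t {0<..<?q}"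
    using q by (simp add: binomial_ring add_ac)
  moreover have "sum ?t {0<..<?q} \<in> K"
    by (rule sum_mem, intro mult_mem_right of_nat_mem[OF assms(2)])
      (simp add: prime_dvd_prime_power_choose[OF assms(1)])
  ultimately show ?thesis by simp
qed

text \<open>Divide all multiplicities by p as long as possible; the size drops each time. The power
  \<open>p ^ a\<close> will be absorbed by Frobenius, and the multiplicity prime to p becomes an
  invertible coefficient.\<close>

lemma mset_eq_repeat_prime_power:
  assumes "prime (p::nat)" "T \<noteq> {#}"
  shows "\<exists>a M g. T = repeat_mset (p ^ a) M \<and> \<not> p dvd count M g"
  using assms(2)
proof (induction "size T" arbitrary: T rule: less_induct)
  case less
  show ?case
  proof (cases "\<exists>g. \<not> p dvd count T g")
    case True
    moreover have "T = repeat_mset (p ^ 0) T" by (intro multiset_eqI) simp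
    ultimately show ?thesis by blast
  next
    case False
    define T' where "T' = Abs_multiset (\<lambda>g. count T g div p)"
    have "{g. 0 < count T g div p} \<subseteq> set_mset T"
      by (metis (mono_tags, lifting) count_eq_zero_iff div_0 mem_Collect_eq not_less_zero subsetI)
    then have "finite {g. 0 < count T g div p}"
      by (rule finite_subset) simp
    then have "count T' g = count T g div p" for g
      unfolding T'_def by (simp add: Abs_multiset_inverse)
    then have T: "T = repeat_mset p T'"
      using False by (intro multiset_eqI) simp
    have "T' \<noteq> {#}" using less.prems T by auto
    moreover have "size T = p * size T'"
      unfolding T by (induction p) auto
    ultimately have "size T' < size T"
      using prime_gt_1_nat[OF assms(1)] by (simp add: nonempty_has_size)
    then obtain a M g where "T' = repeat_mset (p ^ a) M" "\<not> p dvd count M g"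
      using less.hyps \<open>T' \<noteq> {#}\<close> by blast
    then have "T = repeat_mset (p ^ Suc a) M" using T by simp
    then show ?thesis using \<open>\<not> p dvd count M g\<close> by blast
  qed
qed

subsection \<open>Linear extension from monomials to polynomials\<close>

text \<open>With f the indicator of the monomials that represent h, this is the coefficient at h of
  the image of P in the group ring.\<close>

definition linear_ext :: "('m \<Rightarrow> int) \<Rightarrow> ('m \<Rightarrow>\<^sub>0 int) \<Rightarrow> int" where
  "linear_ext f P = (\<Sum>m\<in>Poly_Mapping.keys P. Poly_Mapping.lookup P m * f m)"

lemma linear_ext_superset:
  assumes "finite A" "Poly_Mapping.keys P \<subseteq> A"
  shows "linear_ext f P = (\<Sum>m\<in>A. Poly_Mapping.lookup P m * f m)"
  unfolding linear_ext_def
  by (rule sum.mono_neutral_left) (use assms in \<open>auto simp: in_keys_iff\<close>)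

lemma linear_ext_add: "linear_ext f (P + Q) = linear_ext f P + linear_ext f Q"
proof -
  let ?A = "Poly_Mapping.keys P \<union> Poly_Mapping.keys Q"
  have "Poly_Mapping.keys (P + Q) \<subseteq> ?A" by (rule keys_add)
  then show ?thesis
    by (simp add: linear_ext_superset[of ?A] lookup_add algebra_simps sum.distrib)
qed

lemma linear_ext_zero [simp]: "linear_ext f 0 = 0"
  by (simp add: linear_ext_def)

lemma linear_ext_sum: "linear_ext f (sum P I) = (\<Sum>i\<in>I. linear_ext f (P i))"
  by (induction I rule: infinite_finite_induct) (auto simp: linear_ext_add)

lemma linear_ext_single [simp]: "linear_ext f (Poly_Mapping.single m c) = c * f m"
  by (subst linear_ext_superset[of "{m}"]) auto

lemma poly_mapping_sum_singles:
  "P = (\<Sum>m\<in>Poly_Mapping.keys P. Poly_Mapping.single m (Poly_Mapping.lookup P m))"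
  by (rule poly_mapping_eqI) (auto simp: lookup_sum lookup_single when_def in_keys_iff)

lemma linear_ext_single_mult:
  "linear_ext f (Poly_Mapping.single m c * P) = c * linear_ext (\<lambda>n. f (m + n)) P"
proof -
  have "linear_ext f (Poly_Mapping.single m c * P)
      = (\<Sum>n\<in>Poly_Mapping.keys P. linear_ext f (Poly_Mapping.single (m + n) (c * Poly_Mapping.lookup P n)))"
    by (subst (1) poly_mapping_sum_singles[of P])
      (simp add: sum_distrib_left linear_ext_sum mult_single)
  then show ?thesis by (simp add: linear_ext_def[of _ P] sum_distrib_left mult.assoc)
qed

subsection \<open>Sums of sequences\<close>

context comm_group
begin

lemma seq_sum_empty [simp]: "seq_sum G {#} = \<one>"
  by (simp add: seq_sum_def)

lemma seq_sum_closed [simp]: "seq_over G S \<Longrightarrow> seq_sum G S \<in> carrier G"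
  unfolding seq_sum_def seq_over_def by (rule finprod_closed) auto

text \<open>\<open>seq_sum\<close> has one factor per distinct term, so the factor of x is split
  off; if x is absent from S, its exponent there is 0.\<close>

lemma seq_sum_add_mset:
  assumes "x \<in> carrier G" "seq_over G S"
  shows "seq_sum G (add_mset x S) = x \<otimes> seq_sum G S"
proof -
  let ?A = "set_mset S - {x}"
  let ?r = "\<Otimes>y\<in>?A. y [^] count S y"
  have A: "?A \<subseteq> carrier G" using assms(2) by (auto simp: seq_over_def)
  then have r: "?r \<in> carrier G" by (auto intro!: finprod_closed)
  have "seq_sum G (add_mset x S) = (\<Otimes>y\<in>insert x ?A. y [^] count (add_mset x S) y)"
    unfolding seq_sum_def by simp
  also have "\<dots> = x [^] Suc (count S x) \<otimes> (\<Otimes>y\<in>?A. y [^] count (add_mset x S) y)"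
    using assms(1) A by (subst finprod_insert) (auto intro!: nat_pow_closed)
  also have "(\<Otimes>y\<in>?A. y [^] count (add_mset x S) y) = ?r"
    using A by (intro finprod_cong') auto
  also have "x [^] Suc (count S x) \<otimes> ?r = x \<otimes> (x [^] count S x \<otimes> ?r)"
    using assms(1) r by (simp add: m_ac)
  also have "x [^] count S x \<otimes> ?r = seq_sum G S"
  proof (cases "x \<in># S")
    case True
    then have "set_mset S = insert x ?A" by auto
    then have "seq_sum G S = (\<Otimes>y\<in>insert x ?A. y [^] count S y)"
      unfolding seq_sum_def by simp
    also have "\<dots> = x [^] count S x \<otimes> ?r"
      using assms(1) A by (subst finprod_insert) (auto intro!: nat_pow_closed)
    finally show ?thesis by simp
  next
    case False
    then have "?A = set_mset S" "count S x = 0" by (auto simp: not_in_iff)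
    then show ?thesis using r by (simp add: seq_sum_def)
  qed
  finally show ?thesis .
qed

lemma seq_sum_union:
  assumes "seq_over G S" "seq_over G T"
  shows "seq_sum G (S + T) = seq_sum G S \<otimes> seq_sum G T"
  using assms(1)
proof (induction S)
  case empty
  then show ?case using assms(2) by simp
next
  case (add x S)
  then have "x \<in> carrier G" "seq_over G S" by (auto simp: seq_over_def)
  moreover have "seq_over G (S + T)"
    using add.prems assms(2) by (auto simp: seq_over_def)
  ultimately show ?case using add.IH assms(2) by (simp add: seq_sum_add_mset m_assoc)
qed

lemma seq_over_subset: "seq_over G S \<Longrightarrow> T \<subseteq># S \<Longrightarrow> seq_over G T"
  unfolding seq_over_def using set_mset_mono by blast

lemma zero_sum_diff:
  assumes "seq_over G S" "T \<subseteq># S" "zero_sum G S" "zero_sum G T"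
  shows "zero_sum G (S - T)"
proof -
  have T: "seq_over G T" "seq_over G (S - T)"
    using assms(1,2) seq_over_subset diff_subset_eq_self by blast+
  have "seq_sum G (T + (S - T)) = \<one>"
    using assms by (simp add: zero_sum_def)
  then show ?thesis
    using assms(4) T by (simp add: seq_sum_union zero_sum_def)
qed

lemma zero_sum_union:
  "seq_over G S \<Longrightarrow> seq_over G T \<Longrightarrow> zero_sum G S \<Longrightarrow> zero_sum G T \<Longrightarrow> zero_sum G (S + T)"
  by (simp add: zero_sum_def seq_sum_union)

lemma seq_sum_replicate:
  assumes "x \<in> carrier G"
  shows "seq_sum G (replicate_mset n x) = x [^] n"
  by (induction n)
    (use assms in \<open>auto simp: seq_sum_add_mset seq_over_def m_comm split: if_splits\<close>)

end

subsection \<open>The group ring modulo p as a quotient of a polynomial ring\<close>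

text \<open>Exponent vectors are multisets, and the coefficients stay integral: reduction modulo p
  is left to the ideal.\<close>

abbreviation var :: "'a \<Rightarrow> 'a multiset \<Rightarrow>\<^sub>0 int" where
  "var g \<equiv> Poly_Mapping.single {#g#} 1"

lemma prod_mset_var: "(\<Prod>g\<in>#M. var g) = Poly_Mapping.single M 1"
  by (induction M) (auto simp: mult_single)

lemma var_power: "var g ^ n = Poly_Mapping.single (replicate_mset n g) 1"
  by (induction n) (auto simp: mult_single)

text \<open>The lift to the polynomial ring of a product of the generators 1 - g of the augmentation
  ideal.\<close>

definition aug_prod :: "'a multiset \<Rightarrow> 'a multiset \<Rightarrow>\<^sub>0 int" where
  "aug_prod S = (\<Prod>g\<in>#S. 1 - var g)"

lemma aug_prod_union: "aug_prod (S + T) = aug_prod S * aug_prod T"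
  by (simp add: aug_prod_def)

lemma aug_prod_replicate: "aug_prod (replicate_mset n g) = (1 - var g) ^ n"
  by (simp add: aug_prod_def)

text \<open>Expanding the product gives one signed monomial per set of positions. Indexing by
  positions keeps equal terms of the sequence apart, so coefficients become signed counts of
  subsequences.\<close>

lemma linear_ext_aug_prod:
  assumes "finite I"
  shows "linear_ext f (aug_prod (image_mset g (mset_set I)))
    = (\<Sum>X\<in>Pow I. (- 1) ^ card X * f (image_mset g (mset_set X)))"
proof -
  have "aug_prod (image_mset g (mset_set I)) = (\<Prod>i\<in>I. 1 - var (g i))"
    by (simp add: aug_prod_def prod_unfold_prod_mset multiset.map_comp comp_def)
  also have "\<dots> = (\<Sum>X\<in>Pow I. (- 1) ^ card X * (\<Prod>i\<in>X. var (g i)))"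
    using prod_diff_conv_sum[OF assms, where ?f1.0="\<lambda>_. 1" and ?f2.0="\<lambda>i. var (g i)"] by simp
  also have "\<dots> = (\<Sum>X\<in>Pow I. Poly_Mapping.single (image_mset g (mset_set X)) ((- 1) ^ card X))"
  proof (rule sum.cong)
    fix X
    have "(\<Prod>i\<in>X. var (g i)) = Poly_Mapping.single (image_mset g (mset_set X)) 1"
      using prod_mset_var[of "image_mset g (mset_set X)"]
      by (simp add: prod_unfold_prod_mset multiset.map_comp comp_def)
    then show "(- 1) ^ card X * (\<Prod>i\<in>X. var (g i))
        = Poly_Mapping.single (image_mset g (mset_set X)) ((- 1) ^ card X)"
      by (cases "even (card X)") (auto simp: single_uminus)
  qed simp
  finally show ?thesis by (simp add: linear_ext_sum)
qed

lemma mset_indexed: "\<exists>g. S = image_mset g (mset_set {..<size S})"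
proof -
  obtain xs where "S = mset xs" by (metis ex_mset)
  then have "S = image_mset ((!) xs) (mset_set {..<size S})"
    by (metis atLeast_upt map_nth mset_map mset_set_set mset_upt lessThan_atLeast0 distinct_upt set_upt size_mset)
  then show ?thesis by blast
qed

context comm_group
begin

text \<open>
  The monomial with exponents \<open>M\<close> represents the product of the elements of \<open>M\<close> in \<open>G\<close>;
  variables that do not belong to \<open>G\<close> represent \<open>\<one>\<close>.
\<close>

definition monom_sum :: "'a multiset \<Rightarrow> 'a" where
  "monom_sum M = seq_sum G {#x \<in># M. x \<in> carrier G#}"

text \<open>The kernel of the map onto the group ring of G with coefficients modulo p: every
  coefficient of the image is divisible by p.\<close>

definition group_ring_ideal :: "nat \<Rightarrow> ('a multiset \<Rightarrow>\<^sub>0 int) set" where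
  "group_ring_ideal p =
     {P. \<forall>h\<in>carrier G. int p dvd linear_ext (\<lambda>M. of_bool (monom_sum M = h)) P}"

lemma monom_sum_closed [simp]: "monom_sum M \<in> carrier G"
  unfolding monom_sum_def by (rule seq_sum_closed) (auto simp: seq_over_def)

lemma monom_sum_union: "monom_sum (M + N) = monom_sum M \<otimes> monom_sum N"
  unfolding monom_sum_def filter_union_mset by (rule seq_sum_union) (auto simp: seq_over_def)

lemma monom_sum_eq: "seq_over G M \<Longrightarrow> monom_sum M = seq_sum G M"
  unfolding monom_sum_def seq_over_def
  by (metis (mono_tags, lifting) filter_mset_True filter_mset_cong subsetD)

lemma ring_ideal_group_ring_ideal: "ring_ideal (group_ring_ideal p)"
proof
  fix P Q :: "'a multiset \<Rightarrow>\<^sub>0 int"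
  assume P: "P \<in> group_ring_ideal p"
  show "P + Q \<in> group_ring_ideal p" if "Q \<in> group_ring_ideal p"
    using P that by (auto simp: group_ring_ideal_def linear_ext_add)
  show "Q * P \<in> group_ring_ideal p"
    unfolding group_ring_ideal_def
  proof (safe)
    fix h assume h: "h \<in> carrier G"
    let ?f = "\<lambda>h M. of_bool (monom_sum M = h) :: int"
    have "Q * P = (\<Sum>m\<in>Poly_Mapping.keys Q. Poly_Mapping.single m (Poly_Mapping.lookup Q m) * P)"
      by (subst (1) poly_mapping_sum_singles) (simp add: sum_distrib_right)
    moreover have "int p dvd linear_ext (?f h) (Poly_Mapping.single m c * P)" for m c
    proof -
      \<comment> \<open>Multiplication by a monomial only translates the coefficients, so the
        coefficient at h is a multiple of another coefficient of P.\<close>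
      have "(monom_sum (m + n) = h) = (monom_sum n = inv monom_sum m \<otimes> h)" for n
        using h by (metis monom_sum_union monom_sum_closed inv_solve_left inv_closed)
      then have "(\<lambda>n. ?f h (m + n)) = ?f (inv monom_sum m \<otimes> h)" by auto
      moreover have "int p dvd linear_ext (?f (inv monom_sum m \<otimes> h)) P"
        using P h by (auto simp: group_ring_ideal_def)
      ultimately show ?thesis by (simp add: linear_ext_single_mult)
    qed
    ultimately show "int p dvd linear_ext (?f h) (Q * P)"
      by (simp add: linear_ext_sum dvd_sum)
  qed
qed (auto simp: group_ring_ideal_def)

lemma of_nat_mem_group_ring_ideal: "of_nat p \<in> group_ring_ideal p"
  by (auto simp: group_ring_ideal_def simp flip: single_of_nat)

lemma one_notin_group_ring_ideal:
  assumes "p > 1"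
  shows "1 \<notin> group_ring_ideal p"
proof
  assume "1 \<in> group_ring_ideal p"
  then have "int p dvd linear_ext (\<lambda>M. of_bool (monom_sum M = \<one>)) 1"
    by (auto simp: group_ring_ideal_def)
  moreover have "monom_sum {#} = \<one>" by (simp add: monom_sum_def)
  ultimately show False using assms by (simp flip: single_one)
qed

lemma monom_diff_mem_group_ring_ideal:
  assumes "monom_sum M = monom_sum N"
  shows "Poly_Mapping.single M 1 - Poly_Mapping.single N 1 \<in> group_ring_ideal p"
proof -
  have eq: "Poly_Mapping.single M 1 - Poly_Mapping.single N 1
      = Poly_Mapping.single M 1 + Poly_Mapping.single N (- 1 :: int)"
    by (simp add: single_uminus)
  show ?thesis
    unfolding eq group_ring_ideal_def using assms by (simp add: linear_ext_add)
qed

end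

subsection \<open>The Davenport constant of a p-group\<close>

lemma sum_mset_count_times:
  fixes f :: "'a \<Rightarrow> 'r::comm_semiring_1"
  shows "(\<Sum>g\<in>#M. f g) = (\<Sum>g\<in>set_mset M. of_nat (count M g) * f g)"
proof -
  \<comment> \<open>The index set on the right stays fixed while N grows.\<close>
  have "(\<Sum>g\<in>#N. f g) = (\<Sum>g\<in>set_mset M. of_nat (count N g) * f g)" if "N \<subseteq># M" for N
    using that
  proof (induction N)
    case empty
    then show ?case by simp
  next
    case (add x N)
    then have x: "x \<in># M" and "N \<subseteq># M" by (auto dest: mset_subset_eq_insertD)
    have "of_nat (count (add_mset x N) g) * f g
        = (if g = x then f g else 0) + of_nat (count N g) * f g" for g
      by (simp add: algebra_simps)
    then show ?case using add.IH[OF \<open>N \<subseteq># M\<close>] x by (simp add: sum.distrib)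
  qed
  then show ?thesis by blast
qed

context comm_group
begin

text \<open>By Frobenius \<open>(1 - g) ^ (p ^ m)\<close> is congruent to
  \<open>1 - g ^ (p ^ m)\<close>, which represents 0.\<close>

lemma aug_power_mem:
  assumes "prime p" "g \<in> carrier G" "g [^] (p ^ m) = \<one>"
  shows "(1 - var g) ^ (p ^ m) \<in> group_ring_ideal p"
proof -
  interpret ring_ideal "group_ring_ideal p" by (rule ring_ideal_group_ring_ideal)
  let ?q = "p ^ m"
  have "((1 - var g) + var g) ^ ?q - ((1 - var g) ^ ?q + var g ^ ?q) \<in> group_ring_ideal p"
    by (rule prime_power_add[OF assms(1) of_nat_mem_group_ring_ideal])
  moreover have "seq_over G (replicate_mset ?q g)"
    using assms(2) by (auto simp: seq_over_def split: if_splits)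
  then have "monom_sum {#} = monom_sum (replicate_mset ?q g)"
    using assms by (simp add: monom_sum_eq seq_sum_replicate seq_over_def)
  then have "1 - var g ^ ?q \<in> group_ring_ideal p"
    using monom_diff_mem_group_ring_ideal[of "{#}" "replicate_mset ?q g"] by (simp add: var_power)
  ultimately have "(1 - var g ^ ?q) - (((1 - var g) + var g) ^ ?q - ((1 - var g) ^ ?q + var g ^ ?q))
      \<in> group_ring_ideal p"
    using diff_mem by blast
  then show ?thesis by simp
qed

lemma aug_prod_mono:
  assumes "aug_prod S \<in> group_ring_ideal p" "S \<subseteq># T"
  shows "aug_prod T \<in> group_ring_ideal p"
proof -
  interpret ring_ideal "group_ring_ideal p" by (rule ring_ideal_group_ring_ideal)
  have "aug_prod T = aug_prod (T - S) * aug_prod S"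
    using assms(2) by (simp flip: aug_prod_union)
  then show ?thesis using assms(1) mult_mem by simp
qed

text \<open>By pigeonhole some term occurs at least \<open>p ^ m\<close> times. This bounds the
  length of nonvanishing products, so that a longest one exists.\<close>

lemma aug_prod_mem_of_large_size:
  assumes "prime p" "finite (carrier G)" "order G = p ^ m" "seq_over G S"
    and "size S > card (carrier G) * p ^ m"
  shows "aug_prod S \<in> group_ring_ideal p"
proof -
  have "\<exists>g\<in>#S. count S g \<ge> p ^ m"
  proof (rule ccontr)
    assume "\<not> ?thesis"
    then have "size S \<le> (\<Sum>g\<in>set_mset S. p ^ m)"
      unfolding size_multiset_overloaded_eq by (intro sum_mono) (auto simp: not_le intro: less_imp_le)
    also have "\<dots> \<le> card (carrier G) * p ^ m"
      using assms(2,4) by (auto simp: seq_over_def intro: card_mono)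
    finally show False using assms(5) by simp
  qed
  then obtain g where g: "g \<in># S" "count S g \<ge> p ^ m" by blast
  then have "g \<in> carrier G" using assms(4) by (auto simp: seq_over_def)
  then have "(1 - var g) ^ (p ^ m) \<in> group_ring_ideal p"
    using assms(1-3) pow_order_eq_1[of g] by (intro aug_power_mem) auto
  then have "aug_prod (replicate_mset (p ^ m) g) \<in> group_ring_ideal p"
    by (simp add: aug_prod_replicate)
  then show ?thesis
    by (rule aug_prod_mono) (use g in \<open>simp add: count_le_replicate_mset_subset_eq\<close>)
qed

text \<open>
  Modulo products with more than \<open>size S\<close> factors, \<open>g \<mapsto> 1 - X\<^sub>g\<^sup>P\<close> is additive. Hence the relation
  \<open>zero_sum G T\<close> allows to exchange \<open>P\<close> copies of an element of \<open>S\<close>.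
\<close>

lemma aug_prod_exchange:
  assumes p: "prime p" and S: "seq_over G S"
    and max: "\<And>S'. seq_over G S' \<Longrightarrow> size S' > size S \<Longrightarrow> aug_prod S' \<in> group_ring_ideal p"
    and T: "T \<subseteq># S" "zero_sum G T" "T = repeat_mset (p ^ a) M"
    and g1: "g1 \<in># M"
  shows "(\<Sum>g\<in>#M. aug_prod (S - replicate_mset (p ^ a) g1 + replicate_mset (p ^ a) g))
    \<in> group_ring_ideal p"
proof -
  let ?K = "group_ring_ideal p" and ?P = "p ^ a"
  interpret ring_ideal ?K by (rule ring_ideal_group_ring_ideal)
  define R where "R = S - replicate_mset ?P g1"
  define u where "u g = (1 - var g) ^ ?P" for g :: 'a
  have P: "?P > 0" using p by (simp add: prime_gt_0_nat)
  have M: "g \<in> carrier G" if "g \<in># M" for g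
  proof -
    have "g \<in># T" using that P unfolding T(3) by (simp flip: count_greater_zero_iff)
    then show ?thesis using T(1) S by (auto simp: seq_over_def dest: mset_subset_eqD)
  qed
  have "?P \<le> count T g1"
    using g1 mult_le_mono2[of 1 "count M g1" ?P] unfolding T(3) by simp
  then have "replicate_mset ?P g1 \<subseteq># S"
    using T(1) by (meson count_le_replicate_mset_subset_eq mset_subset_eq_count le_trans)
  then have R: "size R + ?P = size S"
    using size_mset_mono[of "replicate_mset ?P g1" S] by (simp add: R_def size_Diff_submset)
  have R_over: "seq_over G R"
    unfolding R_def using S seq_over_subset diff_subset_eq_self by blast
  \<comment> \<open>The ideal quotient of \<open>?K\<close> by \<open>aug_prod R\<close>. In it all
    \<open>u g * u h\<close> vanish, because R with two blocks of \<open>?P\<close> terms added is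
    longer than S.\<close>
  define K' where "K' = {x. aug_prod R * x \<in> ?K}"
  interpret K': ring_ideal K'
  proof
    fix x y r assume "x \<in> K'"
    then show "r * x \<in> K'"
      using mult_mem[of "aug_prod R * x" r] by (simp add: K'_def mult_ac)
    show "x + y \<in> K'" if "y \<in> K'"
      using \<open>x \<in> K'\<close> that by (simp add: K'_def distrib_left add_mem)
  qed (simp add: K'_def zero_mem)
  have K'I: "x \<in> K'" if "x \<in> ?K" for x
    using that by (simp add: K'_def mult_mem)
  have "u g * u h \<in> K'" if "g \<in># M" "h \<in># M" for g h
  proof -
    have "seq_over G (R + replicate_mset ?P g + replicate_mset ?P h)"
      using R_over M[OF that(1)] M[OF that(2)] by (auto simp: seq_over_def split: if_splits)
    then have "aug_prod (R + replicate_mset ?P g + replicate_mset ?P h) \<in> ?K"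
      by (rule max) (use R P in simp)
    then show ?thesis by (simp add: K'_def u_def aug_prod_union aug_prod_replicate mult.assoc)
  qed
  then have "(\<Prod>g\<in>#M. 1 - u g) - (1 - (\<Sum>g\<in>#M. u g)) \<in> K'"
    by (rule K'.prod_mset_one_minus)
  moreover have "(\<Prod>g\<in>#M. 1 - u g) - (\<Prod>g\<in>#M. var g ^ ?P) \<in> K'"
  proof (intro K'I prod_mset_diff_mem)
    fix g
    have "((1 - var g) + var g) ^ ?P - ((1 - var g) ^ ?P + var g ^ ?P) \<in> ?K"
      by (rule prime_power_add[OF p of_nat_mem_group_ring_ideal])
    then show "1 - u g - var g ^ ?P \<in> ?K" by (simp add: u_def algebra_simps)
  qed
  moreover have "(\<Prod>g\<in>#M. var g ^ ?P) - 1 \<in> K'"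
  proof (rule K'I)
    have "(\<Prod>g\<in>#M. var g ^ ?P) = Poly_Mapping.single T 1"
      unfolding T(3) by (induction M) (auto simp: mult_single var_power)
    moreover have "monom_sum T = monom_sum {#}"
      using T(1,2) seq_over_subset[OF S] by (simp add: monom_sum_eq zero_sum_def seq_over_def)
    ultimately show "(\<Prod>g\<in>#M. var g ^ ?P) - 1 \<in> ?K"
      using monom_diff_mem_group_ring_ideal[of T "{#}"] by simp
  qed
  \<comment> \<open>Modulo \<open>K'\<close>, the product of the \<open>1 - u g\<close> is congruent
    both to 1 minus their sum and, by Frobenius and the zero-sum relation, to 1.\<close>
  ultimately have "((\<Prod>g\<in>#M. 1 - u g) - (1 - (\<Sum>g\<in>#M. u g)))
      - (((\<Prod>g\<in>#M. 1 - u g) - (\<Prod>g\<in>#M. var g ^ ?P)) + ((\<Prod>g\<in>#M. var g ^ ?P) - 1)) \<in> K'"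
    by (rule K'.diff_mem[OF _ K'.add_mem])
  then have "(\<Sum>g\<in>#M. u g) \<in> K'" by simp
  then show ?thesis
    by (simp add: K'_def u_def aug_prod_union aug_prod_replicate sum_mset_distrib_left flip: R_def)
qed

definition zero_sum_free :: "'a multiset \<Rightarrow> bool" where
  "zero_sum_free S \<longleftrightarrow> seq_over G S \<and> (\<forall>T. T \<subseteq># S \<and> zero_sum G T \<longrightarrow> T = {#})"

text \<open>
  A longest nonvanishing product whose multiplicities have the largest sum of squares is
  zero-sum free: an exchange towards an element of larger multiplicity increases that sum.
\<close>

lemma zero_sum_free_of_maximal:
  assumes p: "prime p" and fin: "finite (carrier G)" and S: "seq_over G S"
    and nz: "aug_prod S \<notin> group_ring_ideal p"
    and max: "\<And>S'. seq_over G S' \<Longrightarrow> size S' > size S \<Longrightarrow> aug_prod S' \<in> group_ring_ideal p"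
    and max_sq: "\<And>S'. seq_over G S' \<Longrightarrow> size S' = size S \<Longrightarrow>
      (\<Sum>g\<in>carrier G. (count S' g)\<^sup>2) > (\<Sum>g\<in>carrier G. (count S g)\<^sup>2) \<Longrightarrow>
      aug_prod S' \<in> group_ring_ideal p"
  shows "zero_sum_free S"
  unfolding zero_sum_free_def
proof (intro conjI allI impI S, elim conjE)
  fix T assume T: "T \<subseteq># S" "zero_sum G T"
  let ?K = "group_ring_ideal p"
  interpret ring_ideal ?K by (rule ring_ideal_group_ring_ideal)
  show "T = {#}"
  proof (rule ccontr)
    assume "T \<noteq> {#}"
    then obtain a M g0 where M: "T = repeat_mset (p ^ a) M" "\<not> p dvd count M g0"
      using mset_eq_repeat_prime_power[OF p] by blast
    let ?P = "p ^ a"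
    let ?F = "{g. \<not> p dvd count M g}"
    have P: "?P > 0" using p by (simp add: prime_gt_0_nat)
    have F: "?F \<subseteq> set_mset M" by (auto simp: not_in_iff intro: ccontr)
    have carr: "g \<in> carrier G" if "g \<in># M" for g
    proof -
      have "g \<in># T" using that P unfolding M(1) by (simp flip: count_greater_zero_iff)
      then show ?thesis using T(1) S by (auto simp: seq_over_def dest: mset_subset_eqD)
    qed
    \<comment> \<open>Choosing the least multiplicity in S makes every exchange within
      \<open>?F\<close> go from \<open>g1\<close> to an element at least as frequent.\<close>
    obtain g1 where g1: "g1 \<in> ?F" "\<And>g. g \<in> ?F \<Longrightarrow> count S g1 \<le> count S g"
      using M(2) arg_min_if_finite[of ?F "count S"] F finite_subset
      by (metis (no_types, lifting) empty_iff finite_set_mset mem_Collect_eq not_less)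
    then have g1M: "g1 \<in># M" using F by blast
    define E where "E g = S - replicate_mset ?P g1 + replicate_mset ?P g" for g
    have "?P \<le> count T g1"
      using g1M mult_le_mono2[of 1 "count M g1" ?P] unfolding M(1) by simp
    then have cnt: "?P \<le> count S g1"
      using T(1) by (meson mset_subset_eq_count le_trans)
    then have sub: "replicate_mset ?P g1 \<subseteq># S" by (simp add: count_le_replicate_mset_subset_eq)
    have E1: "E g1 = S" unfolding E_def using sub by simp
    have E: "aug_prod (E g) \<in> ?K" if g: "g \<in> ?F" "g \<noteq> g1" for g
    proof (rule max_sq)
      have gM: "g \<in># M" using g F by blast
      show "seq_over G (E g)"
        using S carr[OF gM] unfolding E_def seq_over_def
        by (auto dest: in_diffD split: if_splits)
      show "size (E g) = size S"
        unfolding E_def size_union size_Diff_submset[OF sub] using size_mset_mono[OF sub] by simp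
      let ?C = "carrier G - {g1, g}"
      have C: "carrier G = insert g1 (insert g ?C)" using carr[OF gM] carr[OF g1M] by auto
      have split: "(\<Sum>h\<in>carrier G. (count S' h)\<^sup>2)
          = (count S' g1)\<^sup>2 + (count S' g)\<^sup>2 + (\<Sum>h\<in>?C. (count S' h)\<^sup>2)" for S'
        by (subst C, subst sum.insert, use fin g in simp, use g in simp,
            subst sum.insert) (use fin g in auto)
      have "(\<Sum>h\<in>?C. (count (E g) h)\<^sup>2) = (\<Sum>h\<in>?C. (count S h)\<^sup>2)"
        by (rule sum.cong) (auto simp: E_def)
      moreover obtain c where c: "count S g1 = c + ?P"
        using cnt by (metis le_add_diff_inverse2)
      then have "count (E g) g1 = c" "count (E g) g = count S g + ?P"
        using g by (auto simp: E_def)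
      \<comment> \<open>The sum of squares grows by \<open>2 * ?P * (count S g - c)\<close>, which
        is positive.\<close>
      moreover have "c + ?P \<le> count S g" using g1(2)[OF g(1)] c by simp
      then have "c < count S g" using P by linarith
      then have "c * ?P < count S g * ?P" using P by (rule mult_strict_right_mono)
      then have "(c + ?P)\<^sup>2 + (count S g)\<^sup>2 < c\<^sup>2 + (count S g + ?P)\<^sup>2"
        using mult.commute[of ?P c] mult.commute[of ?P "count S g"]
        unfolding power2_eq_square distrib_left distrib_right by linarith
      ultimately show "(\<Sum>h\<in>carrier G. (count S h)\<^sup>2) < (\<Sum>h\<in>carrier G. (count (E g) h)\<^sup>2)"
        unfolding split by (simp add: c)
    qed
    have total: "(\<Sum>g\<in>#M. aug_prod (E g)) \<in> ?K"
      unfolding E_def by (rule aug_prod_exchange[OF p S max T M(1) g1M])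
    have split: "(\<Sum>g\<in>#M. aug_prod (E g)) = of_nat (count M g1) * aug_prod S
        + (\<Sum>g\<in>set_mset M - {g1}. of_nat (count M g) * aug_prod (E g))"
      unfolding sum_mset_count_times using g1M E1 by (subst sum.remove[of _ g1]) auto
    \<comment> \<open>Outside \<open>?F\<close> the coefficient is divisible by p; inside, the
      exchanged product vanishes by \<open>E\<close>.\<close>
    have rest: "(\<Sum>g\<in>set_mset M - {g1}. of_nat (count M g) * aug_prod (E g)) \<in> ?K"
    proof (rule sum_mem)
      fix g assume g: "g \<in> set_mset M - {g1}"
      show "of_nat (count M g) * aug_prod (E g) \<in> ?K"
      proof (cases "p dvd count M g")
        case True
        then show ?thesis
          by (rule mult_mem_right[OF of_nat_mem[OF of_nat_mem_group_ring_ideal]])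
      next
        case False
        then show ?thesis using E[of g] g by (intro mult_mem) auto
      qed
    qed
    have c: "of_nat (count M g1) * aug_prod S \<in> ?K"
      using diff_mem[OF total rest] unfolding split by simp
    \<comment> \<open>The one remaining coefficient is invertible modulo p, which forces
      \<open>aug_prod S\<close> itself into the ideal.\<close>
    have "coprime (int (count M g1)) (int p)"
      using g1(1) p by (simp add: coprime_commute prime_imp_coprime)
    then obtain r s where "r * int (count M g1) + s * int p = 1"
      by (metis bezout_int coprime_iff_gcd_eq_1)
    then have "aug_prod S = of_int (r * int (count M g1) + s * int p) * aug_prod S" by simp
    also have "\<dots> = of_int r * (of_nat (count M g1) * aug_prod S)
        + of_int s * (aug_prod S * of_nat p)"
      by (simp add: algebra_simps)
    also have "\<dots> \<in> ?K"
      by (intro add_mem mult_mem c of_nat_mem_group_ring_ideal)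
    finally show False using nz by simp
  qed
qed

end

subsection \<open>Binomial coefficients modulo p\<close>

text \<open>Modulo p only the term k = 0 of the Vandermonde sum survives.\<close>

lemma choose_add_prime_power_less:
  assumes "prime (p::nat)" "j < p ^ e"
  shows "[(p ^ e + m) choose j = m choose j] (mod p)"
proof -
  have "(p ^ e + m) choose j = (\<Sum>k\<le>j. (p ^ e choose k) * (m choose (j - k)))"
    by (rule vandermonde[symmetric])
  also have "\<dots> = (m choose j) + (\<Sum>k\<in>{..j} - {0}. (p ^ e choose k) * (m choose (j - k)))"
    by (subst sum.remove[of _ 0]) auto
  also have "[\<dots> = (m choose j) + 0] (mod p)"
    unfolding cong_0_iff
    by (intro cong_add cong_refl) (use assms in \<open>auto simp: cong_0_iff intro!: dvd_sum dvd_mult2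
      prime_dvd_prime_power_choose\<close>)
  finally show ?thesis by simp
qed

text \<open>Now both end terms of the Vandermonde sum survive, and k = \<open>p ^ e\<close>
  contributes the additional 1.\<close>

lemma choose_add_prime_power_eq:
  assumes "prime (p::nat)"
  shows "[(p ^ e + m) choose p ^ e = Suc (m choose p ^ e)] (mod p)"
proof -
  let ?q = "p ^ e"
  have q: "?q > 0" using assms by (simp add: prime_gt_0_nat)
  have "(?q + m) choose ?q = (\<Sum>k\<le>?q. (?q choose k) * (m choose (?q - k)))"
    by (rule vandermonde[symmetric])
  also have "\<dots> = Suc (m choose ?q) + (\<Sum>k\<in>{..?q} - {0} - {?q}. (?q choose k) * (m choose (?q - k)))"
    using q by (subst sum.remove[of _ 0], simp, simp, subst sum.remove[of _ ?q]) auto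
  also have "[\<dots> = Suc (m choose ?q) + 0] (mod p)"
    by (intro cong_add cong_refl) (use assms in \<open>auto simp: cong_0_iff intro!: dvd_sum dvd_mult2
      prime_dvd_prime_power_choose\<close>)
  finally show ?thesis by simp
qed

lemma choose_mult_prime_power_add:
  assumes "prime (p::nat)" "j < p ^ e"
  shows "[(s * p ^ e + m) choose j = m choose j] (mod p)"
proof (induction s)
  case (Suc s)
  have "[(p ^ e + (s * p ^ e + m)) choose j = (s * p ^ e + m) choose j] (mod p)"
    by (rule choose_add_prime_power_less[OF assms])
  then show ?case using Suc by (simp add: add.assoc) (rule cong_trans)
qed simp

lemma choose_mult_prime_power:
  assumes "prime (p::nat)"
  shows "[s * p ^ e choose p ^ e = s] (mod p)"
proof (induction s)
  case 0
  obtain k where "p ^ e = Suc k"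
    using assms by (metis not0_implies_Suc power_not_zero not_prime_0)
  then show ?case by simp
next
  case (Suc s)
  have "[Suc (s * p ^ e choose p ^ e) = Suc s] (mod p)"
    using cong_add[OF Suc cong_refl[of 1]] by simp
  then show ?case
    using cong_trans[OF choose_add_prime_power_eq[OF assms]] by simp
qed

text \<open>Modulo \<open>p\<close>, \<open>m \<mapsto> (m + q - 1 choose q - 1)\<close> is the indicator of the multiples of \<open>q = p ^ e\<close>.\<close>

lemma dvd_choose_shifted:
  assumes "prime (p::nat)" "\<not> p ^ e dvd m"
  shows "p dvd (m + (p ^ e - 1) choose (p ^ e - 1))"
proof -
  let ?q = "p ^ e"
  have q: "?q > 0" using assms by (simp add: prime_gt_0_nat)
  define r where "r = m mod ?q"
  have r: "0 < r" "r < ?q" using assms(2) q by (auto simp: r_def mod_greater_zero_iff_not_dvd)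
  \<comment> \<open>Since r > 0, adding \<open>?q - 1\<close> carries over and leaves the remainder
    r - 1 < \<open>?q - 1\<close>, at which the binomial coefficient is 0.\<close>
  have eq: "m + (?q - 1) = (m div ?q + 1) * ?q + (r - 1)"
  proof -
    have "(m div ?q + 1) * ?q = m div ?q * ?q + ?q" by simp
    then show ?thesis using r q div_mult_mod_eq[of m ?q] unfolding r_def by linarith
  qed
  have zero: "(r - 1) choose (?q - 1) = 0" using r by simp
  have "[(m div ?q + 1) * ?q + (r - 1) choose (?q - 1) = (r - 1) choose (?q - 1)] (mod p)"
    by (rule choose_mult_prime_power_add[OF assms(1)]) (use q in simp)
  then show ?thesis unfolding eq zero cong_0_iff .
qed

subsection \<open>Integer-valued polynomial functions\<close>

text \<open>Degree is measured by iterated differences: the difference of order j + 1 vanishes. This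
  covers integer-valued polynomials without rational coefficients.\<close>

fun diff_degree_le :: "nat \<Rightarrow> (nat \<Rightarrow> int) \<Rightarrow> bool" where
  "diff_degree_le 0 w \<longleftrightarrow> (\<forall>m. w (Suc m) = w m)"
| "diff_degree_le (Suc j) w \<longleftrightarrow> diff_degree_le j (\<lambda>m. w (Suc m) - w m)"

lemma diff_degree_le_0_iff: "diff_degree_le 0 w \<longleftrightarrow> (\<exists>c. w = (\<lambda>_. c))"
proof
  assume "diff_degree_le 0 w"
  then have "w m = w 0" for m by (induction m) auto
  then show "\<exists>c. w = (\<lambda>_. c)" by blast
qed auto

lemma diff_degree_le_Suc: "diff_degree_le j w \<Longrightarrow> diff_degree_le (Suc j) w"
proof (induction j arbitrary: w)
  case (Suc j)
  then have "diff_degree_le j (\<lambda>m. w (Suc m) - w m)" by simp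
  then have "diff_degree_le (Suc j) (\<lambda>m. w (Suc m) - w m)" by (rule Suc.IH)
  then show ?case by (subst diff_degree_le.simps(2))
qed simp

lemma diff_degree_le_mono: "diff_degree_le j w \<Longrightarrow> j \<le> k \<Longrightarrow> diff_degree_le k w"
  by (rule dec_induct[of j k]) (auto dest: diff_degree_le_Suc simp del: diff_degree_le.simps)

lemma diff_degree_le_add:
  "diff_degree_le j u \<Longrightarrow> diff_degree_le j v \<Longrightarrow> diff_degree_le j (\<lambda>m. u m + v m)"
proof (induction j arbitrary: u v)
  case (Suc j)
  then have "diff_degree_le j (\<lambda>m. (u (Suc m) - u m) + (v (Suc m) - v m))" by simp
  then show ?case by (simp add: algebra_simps)
qed auto

lemma diff_degree_le_scale: "diff_degree_le j u \<Longrightarrow> diff_degree_le j (\<lambda>m. c * u m)"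
proof (induction j arbitrary: u)
  case (Suc j)
  then have "diff_degree_le j (\<lambda>m. c * (u (Suc m) - u m))" by simp
  then show ?case by (simp add: algebra_simps)
qed auto

text \<open>Discrete Leibniz rule: the difference of u v is the sum of (du) v, u (dv) and (du) (dv),
  each handled by induction on i + j.\<close>

lemma diff_degree_le_mult:
  "diff_degree_le i u \<Longrightarrow> diff_degree_le j v \<Longrightarrow> diff_degree_le (i + j) (\<lambda>m. u m * v m)"
proof (induction "i + j" arbitrary: i j u v rule: less_induct)
  case less
  show ?case
  proof (cases "i = 0 \<or> j = 0")
    case True
    then show ?thesis
    proof
      assume "i = 0"
      then obtain c where "u = (\<lambda>_. c)" using less.prems(1) diff_degree_le_0_iff by blast
      then show ?thesis using less.prems(2) \<open>i = 0\<close> by (simp add: diff_degree_le_scale)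
    next
      assume "j = 0"
      then obtain c where "v = (\<lambda>_. c)" using less.prems(2) diff_degree_le_0_iff by blast
      then show ?thesis
        using diff_degree_le_scale[OF less.prems(1), of c] \<open>j = 0\<close> by (simp add: mult.commute)
    qed
  next
    case False
    then obtain i' j' where ij: "i = Suc i'" "j = Suc j'" by (metis not0_implies_Suc)
    let ?du = "\<lambda>m. u (Suc m) - u m" and ?dv = "\<lambda>m. v (Suc m) - v m"
    have du: "diff_degree_le i' ?du" and dv: "diff_degree_le j' ?dv"
      using less.prems ij by auto
    have "diff_degree_le (i' + j) (\<lambda>m. ?du m * v m)"
      by (rule less.hyps) (use du less.prems ij in auto)
    moreover have "diff_degree_le (i + j') (\<lambda>m. u m * ?dv m)"
      by (rule less.hyps) (use dv less.prems ij in auto)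
    moreover have "diff_degree_le (i' + j') (\<lambda>m. ?du m * ?dv m)"
      by (rule less.hyps) (use du dv ij in auto)
    \<comment> \<open>The third summand has a bound one lower than the other two and is padded to
      match.\<close>
    then have "diff_degree_le (Suc (i' + j')) (\<lambda>m. ?du m * ?dv m)"
      by (rule diff_degree_le_Suc)
    ultimately have "diff_degree_le (Suc (i' + j')) (\<lambda>m. ?du m * v m + u m * ?dv m + ?du m * ?dv m)"
      using ij by (intro diff_degree_le_add) (auto simp del: diff_degree_le.simps)
    moreover have "(\<lambda>m. ?du m * v m + u m * ?dv m + ?du m * ?dv m)
        = (\<lambda>m. u (Suc m) * v (Suc m) - u m * v m)"
      by (auto simp: algebra_simps)
    ultimately show ?thesis using ij by simp
  qed
qed

lemma diff_degree_le_choose: "diff_degree_le l (\<lambda>m. int ((m + s) choose l))"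
proof (induction l)
  case (Suc l)
  then show ?case by (simp add: algebra_simps)
qed auto

lemma diff_degree_le_prod:
  assumes "finite B" "\<And>b. b \<in> B \<Longrightarrow> diff_degree_le q (w b)"
  shows "diff_degree_le (card B * q) (\<lambda>m. \<Prod>b\<in>B. w b m)"
  using assms
proof (induction B)
  case (insert b B)
  then have "diff_degree_le (q + card B * q) (\<lambda>m. w b m * (\<Prod>b\<in>B. w b m))"
    by (intro diff_degree_le_mult) auto
  then show ?case using insert.hyps by simp
qed simp

text \<open>The difference of w is expanded by induction; summation turns \<open>m choose l\<close>
  into \<open>m choose Suc l\<close>, with constant term \<open>w 0\<close>.\<close>

lemma newton_expansion:
  assumes "diff_degree_le j w"
  shows "\<exists>c. \<forall>m. w m = (\<Sum>l\<le>j. c l * int (m choose l))"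
  using assms
proof (induction j arbitrary: w)
  case 0
  then show ?case by (auto simp: diff_degree_le_0_iff simp del: diff_degree_le.simps)
next
  case (Suc j)
  then obtain c where c: "\<And>m. w (Suc m) - w m = (\<Sum>l\<le>j. c l * int (m choose l))" by auto
  define c' where "c' l = (case l of 0 \<Rightarrow> w 0 | Suc l \<Rightarrow> c l)" for l
  have split: "(\<Sum>l\<le>Suc j. c' l * int (m choose l)) = w 0 + (\<Sum>l\<le>j. c l * int (m choose Suc l))" for m
    by (simp only: sum.atMost_Suc_shift) (simp add: c'_def)
  have "w m = (\<Sum>l\<le>Suc j. c' l * int (m choose l))" for m
  proof (induction m)
    case 0
    then show ?case by (simp only: split) simp
  next
    case (Suc m)
    have "w (Suc m) = w m + (\<Sum>l\<le>j. c l * int (m choose l))" using c[of m] by simp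
    also have "\<dots> = w 0 + (\<Sum>l\<le>j. c l * int (Suc m choose Suc l))"
      unfolding Suc split by (simp add: sum.distrib algebra_simps)
    finally show ?case by (simp only: split)
  qed
  then show ?case by blast
qed

section \<open>Vanishing products and the value of the Davenport constant\<close>

lemma submset_of_size: "l \<le> size S \<Longrightarrow> \<exists>T. T \<subseteq># S \<and> size T = l"
  by (metis ex_mset size_mset mset_append append_take_drop_id length_take min.absorb2 mset_subset_eq_add_left)

lemma dvd_sum_single:
  fixes f :: "'i \<Rightarrow> int"
  assumes "finite A" "a \<in> A" "c dvd sum f A" "\<And>x. x \<in> A - {a} \<Longrightarrow> c dvd f x"
  shows "c dvd f a"
proof -
  have "c dvd sum f (A - {a})" using assms(4) by (rule dvd_sum)
  then show ?thesis using assms(1-3) by (simp add: sum.remove dvd_add_left_iff)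
qed

context comm_group
begin

lemma davenport_eqI:
  assumes "zero_sum_free S"
    and "\<And>S'. seq_over G S' \<Longrightarrow> size S' = Suc (size S) \<Longrightarrow> \<exists>T. T \<subseteq># S' \<and> T \<noteq> {#} \<and> zero_sum G T"
  shows "davenport G = Suc (size S)"
  unfolding davenport_def
proof (rule Least_equality)
  show "0 < Suc (size S) \<and> (\<forall>S'. seq_over G S' \<and> size S' = Suc (size S) \<longrightarrow>
      (\<exists>T. T \<subseteq># S' \<and> T \<noteq> {#} \<and> zero_sum G T))"
    using assms(2) by blast
next
  fix l assume l: "0 < l \<and> (\<forall>S. seq_over G S \<and> size S = l \<longrightarrow>
      (\<exists>T. T \<subseteq># S \<and> T \<noteq> {#} \<and> zero_sum G T))"
  show "Suc (size S) \<le> l"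
  proof (rule ccontr)
    assume "\<not> ?thesis"
    then obtain S1 where S1: "S1 \<subseteq># S" "size S1 = l"
      using submset_of_size[of l S] by auto
    then have "seq_over G S1"
      using assms(1) seq_over_subset by (auto simp: zero_sum_free_def)
    then obtain T where "T \<subseteq># S1" "T \<noteq> {#}" "zero_sum G T" using l S1 by blast
    then show False
      using assms(1) S1(1) subset_mset.order_trans by (auto simp: zero_sum_free_def)
  qed
qed

lemma monom_sum_eq_one_iff: "seq_over G M \<Longrightarrow> monom_sum M = \<one> \<longleftrightarrow> zero_sum G M"
  by (simp add: monom_sum_eq zero_sum_def)

lemma image_mset_subset_indexed:
  assumes "S = image_mset g (mset_set I)" "finite I" "X \<subseteq> I"
  shows "image_mset g (mset_set X) \<subseteq># S"
  unfolding assms(1) using assms(2,3) by (intro image_mset_subseteq_mono) (simp add: subset_imp_msubset_mset_set)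

text \<open>The coefficient at \<one> is the signed number of zero-sum sets of positions. The empty
  set contributes 1, so it cannot be the only one.\<close>

lemma exists_zero_sum_of_aug_prod_mem:
  assumes "p > 1" "seq_over G S" "aug_prod S \<in> group_ring_ideal p"
  shows "\<exists>T. T \<subseteq># S \<and> T \<noteq> {#} \<and> zero_sum G T"
proof (rule ccontr)
  assume *: "\<not> ?thesis"
  obtain g where g: "S = image_mset g (mset_set {..<size S})"
    using mset_indexed by blast
  let ?I = "{..<size S}"
  let ?f = "\<lambda>X. (- 1) ^ card X * of_bool (monom_sum (image_mset g (mset_set X)) = \<one>) :: int"
  have "int p dvd linear_ext (\<lambda>M. of_bool (monom_sum M = \<one>)) (aug_prod (image_mset g (mset_set ?I)))"
    using assms(3) g by (simp add: group_ring_ideal_def)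
  then have "int p dvd (\<Sum>X\<in>Pow ?I. ?f X)"
    by (simp add: linear_ext_aug_prod)
  moreover have "?f X = 0" if "X \<in> Pow ?I - {{}}" for X
  proof -
    have "image_mset g (mset_set X) \<subseteq># S"
      using g that by (intro image_mset_subset_indexed[OF g]) auto
    moreover have "image_mset g (mset_set X) \<noteq> {#}"
      using that finite_subset[of X ?I] by (auto simp: mset_set_empty_iff)
    ultimately show ?thesis
      using * assms(2) seq_over_subset monom_sum_eq_one_iff by auto
  qed
  ultimately have "int p dvd ?f {}"
    by (intro dvd_sum_single[of "Pow ?I" "{}" "int p" ?f]) auto
  then show False using assms(1) by (simp add: monom_sum_eq_one_iff seq_over_def zero_sum_def)
qed

text \<open>Olson's theorem, with the Davenport constant in place of its explicit value.\<close>

lemma davenport_p_group: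
  assumes p: "prime p" and fin: "finite (carrier G)" and ord: "order G = p ^ m"
  shows "\<And>S. seq_over G S \<Longrightarrow> davenport G \<le> size S \<Longrightarrow> aug_prod S \<in> group_ring_ideal p"
    and "\<exists>F. zero_sum_free F \<and> davenport G = Suc (size F)"
proof -
  let ?K = "group_ring_ideal p"
  have p1: "p > 1" using p by (rule prime_gt_1_nat)
  define P where "P S \<longleftrightarrow> seq_over G S \<and> aug_prod S \<notin> ?K" for S
  have "P {#}" using one_notin_group_ring_ideal[OF p1] by (simp add: P_def aug_prod_def seq_over_def)
  moreover have "\<forall>S. P S \<longrightarrow> size S < Suc (card (carrier G) * p ^ m)"
    using aug_prod_mem_of_large_size[OF p fin ord] by (auto simp: P_def less_Suc_eq_le intro: leI)
  ultimately have "\<exists>S0. P S0 \<and> (\<forall>S. P S \<longrightarrow> size S \<le> size S0)"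
    by (rule Lattices_Big.ex_has_greatest_nat)
  then obtain S0 where S0: "P S0" "\<And>S. P S \<Longrightarrow> size S \<le> size S0" by blast
  \<comment> \<open>After the length, the sum of squares is maximised among the nonvanishing
    products of that length.\<close>
  define sq where "sq S = (\<Sum>g\<in>carrier G. (count S g)\<^sup>2)" for S
  let ?P = "\<lambda>S. P S \<and> size S = size S0"
  have "sq S \<le> card (carrier G) * (size S0)\<^sup>2" if "size S = size S0" for S
  proof -
    have "(count S g)\<^sup>2 \<le> (size S0)\<^sup>2" for g
      using count_le_size[of S g] that by (simp add: power_mono)
    then show ?thesis
      using sum_bounded_above[of "carrier G" "\<lambda>g. (count S g)\<^sup>2" "(size S0)\<^sup>2"] by (simp add: sq_def)
  qed
  then have "\<forall>S. ?P S \<longrightarrow> sq S < Suc (card (carrier G) * (size S0)\<^sup>2)"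
    by (simp add: less_Suc_eq_le)
  with S0(1) have "\<exists>S. ?P S \<and> (\<forall>S'. ?P S' \<longrightarrow> sq S' \<le> sq S)"
    by (intro Lattices_Big.ex_has_greatest_nat[of ?P S0 sq]) auto
  then obtain S where S: "P S" "size S = size S0"
    and S_sq: "\<And>S'. P S' \<Longrightarrow> size S' = size S0 \<Longrightarrow> sq S' \<le> sq S" by blast
  have large: "aug_prod S' \<in> ?K" if "seq_over G S'" "size S < size S'" for S'
    using S0(2)[of S'] that S(2) by (auto simp: P_def)
  have "aug_prod S' \<in> ?K" if "seq_over G S'" "size S' = size S" "sq S < sq S'" for S'
    using S_sq[of S'] that S(2) by (auto simp: P_def)
  then have zsf: "zero_sum_free S"
    using S(1) large by (intro zero_sum_free_of_maximal[OF p fin]) (auto simp: P_def sq_def)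
  have D: "davenport G = Suc (size S)"
    using zsf by (rule davenport_eqI) (auto intro!: exists_zero_sum_of_aug_prod_mem[OF p1] large)
  show "\<exists>F. zero_sum_free F \<and> davenport G = Suc (size F)" using zsf D by blast
  show "aug_prod S' \<in> ?K" if "seq_over G S'" "davenport G \<le> size S'" for S'
    using large that D by simp
qed

subsection \<open>Zero-sum subsequences of prescribed lengths\<close>

text \<open>\<open>card X choose j\<close> counts the j-subsets J of X. After exchanging the sums, J
  is fixed and X = J \<union> Y; the signed number of Y completing J to sum zero is, up to sign, a
  coefficient of the product over I - J, which has at least D factors.\<close>

lemma alternating_count_choose:
  assumes nil: "\<And>S. seq_over G S \<Longrightarrow> D \<le> size S \<Longrightarrow> aug_prod S \<in> group_ring_ideal p"
    and fin: "finite I" and g: "\<And>i. i \<in> I \<Longrightarrow> g i \<in> carrier G" and size: "D + j \<le> card I"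
  shows "int p dvd (\<Sum>X\<in>Pow I. (- 1) ^ card X *
    of_bool (zero_sum G (image_mset g (mset_set X))) * int (card X choose j))"
proof -
  let ?Z = "\<lambda>X. image_mset g (mset_set X)"
  let ?J = "{J \<in> Pow I. card J = j}"
  let ?t = "\<lambda>X. (- 1) ^ card X * of_bool (zero_sum G (?Z X)) :: int"
  have over: "seq_over G (?Z X)" if "X \<subseteq> I" for X
    using g that by (cases "finite X") (auto simp: seq_over_def)
  have "(\<Sum>X\<in>Pow I. ?t X * int (card X choose j))
      = (\<Sum>X\<in>Pow I. \<Sum>J\<in>?J. if J \<subseteq> X then ?t X else 0)"
  proof (rule sum.cong)
    fix X assume "X \<in> Pow I"
    then have X: "X \<subseteq> I" "finite X" using fin finite_subset by auto
    have "(\<Sum>J\<in>?J. if J \<subseteq> X then ?t X else 0) = (\<Sum>J\<in>{J\<in>?J. J \<subseteq> X}. ?t X)"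
      using fin by (intro sum.inter_filter[symmetric]) auto
    also have "{J\<in>?J. J \<subseteq> X} = {J. J \<subseteq> X \<and> card J = j}" using X by auto
    finally show "?t X * int (card X choose j) = (\<Sum>J\<in>?J. if J \<subseteq> X then ?t X else 0)"
      using n_subsets[OF X(2), of j] by (simp add: mult.commute)
  qed simp
  also have "\<dots> = (\<Sum>J\<in>?J. \<Sum>X\<in>Pow I. if J \<subseteq> X then ?t X else 0)"
    by (rule sum.swap)
  also have "int p dvd \<dots>"
  proof (rule dvd_sum)
    fix J assume J: "J \<in> ?J"
    then have Jfin: "finite J" using fin finite_subset by auto
    let ?h = "inv seq_sum G (?Z J)"
    have h: "?h \<in> carrier G" using over[of J] J by auto
    have "(\<Sum>X\<in>Pow I. if J \<subseteq> X then ?t X else 0) = (\<Sum>X\<in>{X\<in>Pow I. J \<subseteq> X}. ?t X)"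
      using fin by (intro sum.inter_filter[symmetric]) auto
    also have "\<dots> = (\<Sum>Y\<in>Pow (I - J). ?t (J \<union> Y))"
      by (rule sum.reindex_bij_witness[of _ "\<lambda>Y. J \<union> Y" "\<lambda>X. X - J"]) (use J in \<open>auto simp: Un_absorb1\<close>)
    also have "\<dots> = (\<Sum>Y\<in>Pow (I - J). (- 1) ^ j * ((- 1) ^ card Y * of_bool (monom_sum (?Z Y) = ?h)))"
    proof (rule sum.cong)
      fix Y assume Y: "Y \<in> Pow (I - J)"
      then have Yfin: "finite Y" using fin finite_subset by auto
      have disj: "J \<inter> Y = {}" using Y by auto
      have card: "card (J \<union> Y) = j + card Y"
        using J Jfin Yfin disj by (simp add: card_Un_disjoint)
      have oJ: "seq_over G (?Z J)" and oY: "seq_over G (?Z Y)" using over J Y by auto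
      have "?Z (J \<union> Y) = ?Z J + ?Z Y"
        using mset_set_Union[OF Jfin Yfin disj] by simp
      then have "zero_sum G (?Z (J \<union> Y)) \<longleftrightarrow> monom_sum (?Z Y) = ?h"
        using oJ oY by (simp add: zero_sum_def seq_sum_union monom_sum_eq)
          (metis inv_comm inv_equality inv_inv seq_sum_closed inv_closed r_inv l_inv)
      then show "?t (J \<union> Y) = (- 1) ^ j * ((- 1) ^ card Y * of_bool (monom_sum (?Z Y) = ?h))"
        by (simp add: card power_add)
    qed simp
    also have "\<dots> = (- 1) ^ j * linear_ext (\<lambda>M. of_bool (monom_sum M = ?h)) (aug_prod (?Z (I - J)))"
      by (simp only: linear_ext_aug_prod[OF finite_Diff[OF fin]] sum_distrib_left)
    also have "int p dvd \<dots>"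
    proof (rule dvd_mult)
      have "D \<le> size (?Z (I - J))"
        using size J Jfin by (simp add: card_Diff_subset)
      then have "aug_prod (?Z (I - J)) \<in> group_ring_ideal p"
        by (intro nil over) auto
      then show "int p dvd linear_ext (\<lambda>M. of_bool (monom_sum M = ?h)) (aug_prod (?Z (I - J)))"
        using h by (simp add: group_ring_ideal_def)
    qed
    finally show "int p dvd (\<Sum>X\<in>Pow I. if J \<subseteq> X then ?t X else 0)" .
  qed
  finally show ?thesis .
qed

lemma alternating_count_polynomial:
  assumes nil: "\<And>S. seq_over G S \<Longrightarrow> D \<le> size S \<Longrightarrow> aug_prod S \<in> group_ring_ideal p"
    and fin: "finite I" and g: "\<And>i. i \<in> I \<Longrightarrow> g i \<in> carrier G" and size: "D + j \<le> card I"
    and w: "diff_degree_le j w"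
  shows "int p dvd (\<Sum>X\<in>Pow I. (- 1) ^ card X *
    of_bool (zero_sum G (image_mset g (mset_set X))) * w (card X))"
proof -
  let ?t = "\<lambda>X. (- 1) ^ card X * of_bool (zero_sum G (image_mset g (mset_set X))) :: int"
  obtain c where c: "\<And>m. w m = (\<Sum>l\<le>j. c l * int (m choose l))"
    using newton_expansion[OF w] by blast
  have "(\<Sum>X\<in>Pow I. ?t X * w (card X)) = (\<Sum>X\<in>Pow I. \<Sum>l\<le>j. c l * (?t X * int (card X choose l)))"
    unfolding c sum_distrib_left by (intro sum.cong refl) (simp only: mult_ac)
  also have "\<dots> = (\<Sum>l\<le>j. c l * (\<Sum>X\<in>Pow I. ?t X * int (card X choose l)))"
    by (subst sum.swap) (simp only: sum_distrib_left)
  also have "int p dvd \<dots>"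
    by (intro dvd_sum dvd_mult alternating_count_choose[OF nil fin g]) (use size in auto)
  finally show ?thesis .
qed

lemma exists_zero_sum_length:
  assumes p: "prime p" and fin: "finite (carrier G)" and ord: "order G = p ^ m"
    and B: "finite B" "\<And>b. b \<in> B \<Longrightarrow> \<not> p dvd b"
    and U: "seq_over G U" "davenport G + (p ^ e - 1) + card B * p ^ e \<le> size U"
  shows "\<exists>Z n. Z \<subseteq># U \<and> zero_sum G Z \<and> n > 0 \<and> size Z = n * p ^ e \<and> (\<forall>b\<in>B. [n \<noteq> b] (mod p))"
proof (rule ccontr)
  assume *: "\<not> ?thesis"
  let ?q = "p ^ e"
  obtain g where g: "U = image_mset g (mset_set {..<size U})"
    using mset_indexed by blast
  let ?I = "{..<size U}"
  let ?Z = "\<lambda>X. image_mset g (mset_set X)"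
  \<comment> \<open>The first factor kills lengths not divisible by \<open>?q\<close>, the second
    kills lengths \<open>n * ?q\<close> with n in B modulo p. The forms \<open>n + 0\<close> and
    \<open>+ - int b\<close> fit the degree lemmas.\<close>
  define w where "w n = int ((n + (?q - 1)) choose (?q - 1)) * (\<Prod>b\<in>B. int ((n + 0) choose ?q) + - int b)" for n
  let ?t = "\<lambda>X. (- 1) ^ card X * of_bool (zero_sum G (?Z X)) * w (card X)"
  have "diff_degree_le (?q - 1 + card B * ?q) w"
    unfolding w_def
    by (intro diff_degree_le_mult diff_degree_le_choose diff_degree_le_prod[OF B(1)] diff_degree_le_add)
      (auto intro: diff_degree_le_mono[of 0])
  moreover have gi: "g i \<in> carrier G" if "i \<in> ?I" for i
  proof -
    have "g i \<in># U" using that by (subst g) auto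
    then show ?thesis using U(1) by (auto simp: seq_over_def)
  qed
  ultimately have "int p dvd (\<Sum>X\<in>Pow ?I. ?t X)"
    using U(2)
    by (intro alternating_count_polynomial[OF davenport_p_group(1)[OF p fin ord]]) (auto simp: add.assoc)
  moreover have "int p dvd ?t X"
    if X: "X \<in> Pow ?I - {{}}" for X
  proof (cases "zero_sum G (?Z X)")
    case True
    have sub: "?Z X \<subseteq># U" using X by (intro image_mset_subset_indexed[OF g]) auto
    have "card X > 0" using X finite_subset[of X ?I] by (auto simp: card_gt_0_iff)
    show ?thesis
    proof (cases "?q dvd card X")
      case False
      then have "int p dvd int ((card X + (?q - 1)) choose (?q - 1))"
        using dvd_choose_shifted[OF p] by (simp only: int_dvd_int_iff)
      then show ?thesis by (simp add: w_def)
    next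
      case True
      then obtain n where n: "card X = n * ?q" by (metis dvdE mult.commute)
      then have "n > 0" using \<open>card X > 0\<close> by auto
      then obtain b where b: "b \<in> B" "[n = b] (mod p)"
        using * sub \<open>zero_sum G (?Z X)\<close> n by (metis size_image_mset size_mset_set)
      have "[n * ?q choose ?q = b] (mod p)"
        using choose_mult_prime_power[OF p] b(2) by (rule cong_trans)
      then have "int p dvd int (card X choose ?q) - int b"
        unfolding n by (simp add: cong_iff_dvd_diff flip: cong_int_iff)
      then have "int p dvd (\<Prod>b\<in>B. int ((card X + 0) choose ?q) + - int b)"
        using b(1) B(1) by (intro dvd_prodI[THEN dvd_trans[rotated]] ) auto
      then show ?thesis by (simp add: w_def)
    qed
  qed auto
  ultimately have "int p dvd ?t {}"
    by (intro dvd_sum_single[of "Pow ?I" "{}" "int p" ?t]) auto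
  \<comment> \<open>Hence the weight of the empty subsequence is the product of the
    \<open>- int b\<close>, which is prime to p.\<close>
  moreover have "0 choose ?q = 0"
    by (rule binomial_eq_0) (use p in \<open>simp add: prime_gt_0_nat\<close>)
  ultimately have "int p dvd (\<Prod>b\<in>B. - int b)"
    by (simp add: w_def zero_sum_def)
  then obtain b where "b \<in> B" "int p dvd - int b"
    using p B(1) prime_dvd_prod_iff[of B "int p"] by auto
  then show False using B(2) by simp
qed

end

section \<open>Combining and counting lengths of zero-sum subsequences\<close>

context comm_group
begin

definition has_zero_sum :: "'a multiset \<Rightarrow> nat \<Rightarrow> bool" where
  "has_zero_sum S l \<longleftrightarrow> (\<exists>Z. Z \<subseteq># S \<and> size Z = l \<and> zero_sum G Z)"

lemma has_zero_sumI: "Z \<subseteq># S \<Longrightarrow> zero_sum G Z \<Longrightarrow> size Z = l \<Longrightarrow> has_zero_sum S l"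
  by (auto simp: has_zero_sum_def)

lemma has_zero_sum_mono: "has_zero_sum S l \<Longrightarrow> S \<subseteq># S' \<Longrightarrow> has_zero_sum S' l"
  unfolding has_zero_sum_def using subset_mset.order_trans by blast

lemma has_zero_sum_union:
  assumes "seq_over G (S + T)" "has_zero_sum S l" "has_zero_sum T l'"
  shows "has_zero_sum (S + T) (l + l')"
proof -
  obtain Y Z where Y: "Y \<subseteq># S" "size Y = l" "zero_sum G Y"
    and Z: "Z \<subseteq># T" "size Z = l'" "zero_sum G Z"
    using assms(2,3) by (auto simp: has_zero_sum_def)
  have "seq_over G Y" "seq_over G Z"
    using assms(1) Y(1) Z(1) by (auto simp: seq_over_def dest!: set_mset_mono)
  then have "zero_sum G (Y + Z)" using Y(3) Z(3) by (rule zero_sum_union)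
  moreover have "Y + Z \<subseteq># S + T" using Y(1) Z(1) by (rule subset_mset.add_mono)
  ultimately show ?thesis using Y(2) Z(2) by (intro has_zero_sumI[of "Y + Z"]) auto
qed

lemma has_zero_sum_complement:
  assumes "seq_over G T" "zero_sum G T" "has_zero_sum T l"
  shows "has_zero_sum T (size T - l)"
proof -
  obtain Z where Z: "Z \<subseteq># T" "size Z = l" "zero_sum G Z"
    using assms(3) by (auto simp: has_zero_sum_def)
  show ?thesis
    by (rule has_zero_sumI[of "T - Z"])
      (use Z zero_sum_diff[OF assms(1) Z(1) assms(2)] in \<open>auto simp: size_Diff_submset\<close>)
qed

end

text \<open>Here q denotes a power of p; the final theorem instantiates it with the exponent, and
  \<open>D_le\<close> with the bound given by the ceiling.\<close>

locale p_group_davenport = comm_group G for G (structure) +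
  fixes p m e q D d :: nat
  assumes p: "prime p" and fin: "finite (carrier G)" and ord: "order G = p ^ m"
  defines "q \<equiv> p ^ e" and "D \<equiv> davenport G"
  assumes D_le: "D \<le> d * q"
begin

lemma q_pos: "q > 0"
  using p by (simp add: q_def prime_gt_0_nat)

lemma D_pos: "D > 0"
  using davenport_p_group(2)[OF p fin ord] by (auto simp: D_def)

lemma d_pos: "d > 0"
  using D_le D_pos by (cases d) auto

lemma exists_length_avoiding:
  assumes "B \<subseteq> {1..<p}" "seq_over G U" "D + (q - 1) + card B * q \<le> size U"
  obtains Z n where "Z \<subseteq># U" "zero_sum G Z" "0 < n" "size Z = n * q" "\<forall>b\<in>B. [n \<noteq> b] (mod p)"
proof -
  have "\<not> p dvd b" if "b \<in> B" for b
    using that assms(1) by (auto dest!: dvd_imp_le)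
  moreover have "finite B" using assms(1) by (rule finite_subset) simp
  ultimately show ?thesis
    using that exists_zero_sum_length[OF p fin ord _ _ assms(2)] assms(3)
    unfolding q_def D_def by blast
qed

text \<open>With nothing to avoid, length D + q - 1 < (d + 1) q suffices, and cutting U down to it
  forces n \<le> d.\<close>

lemma has_zero_sum_short:
  assumes "seq_over G U" "D + (q - 1) \<le> size U"
  shows "\<exists>n. 0 < n \<and> n \<le> d \<and> has_zero_sum U (n * q)"
proof -
  obtain V where V: "V \<subseteq># U" "size V = D + (q - 1)"
    using submset_of_size[OF assms(2)] by blast
  then obtain Z n where Z: "Z \<subseteq># V" "zero_sum G Z" "0 < n" "size Z = n * q"
    using seq_over_subset[OF assms(1)] by (auto intro: exists_length_avoiding[of "{}" V])
  have "n * q < Suc d * q"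
    using size_mset_mono[OF Z(1)] Z(4) V(2) D_le q_pos by simp
  then have "n \<le> d" by (simp only: mult_less_cancel2) simp
  then show ?thesis
    using Z V(1) subset_mset.order_trans has_zero_sumI by blast
qed

lemma has_zero_sum_prime:
  assumes "seq_over G U" "p * q + D - 1 \<le> size U" "d \<le> p"
  shows "has_zero_sum U (p * q)"
proof -
  obtain V where V: "V \<subseteq># U" "size V = p * q + D - 1"
    using submset_of_size[OF assms(2)] by blast
  have p1: "p > 0" using p by (simp add: prime_gt_0_nat)
  then obtain r where r: "p = Suc r" using gr0_implies_Suc by blast
  \<comment> \<open>An equality, as (q - 1) + (p - 1) q = p q - 1. Avoiding all nonzero residues
    leaves p dvd n, and \<open>size V\<close> < 2 p q leaves n = p.\<close>
  have "D + (q - 1) + card {1..<p} * q \<le> size V"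
    using V(2) q_pos D_pos by (simp add: r)
  then obtain Z n where Z: "Z \<subseteq># V" "zero_sum G Z" "0 < n" "size Z = n * q"
    and n: "\<forall>b\<in>{1..<p}. [n \<noteq> b] (mod p)"
    using seq_over_subset[OF assms(1) V(1)] by (elim exists_length_avoiding[OF subset_refl])
  have "p dvd n"
  proof (rule ccontr)
    assume "\<not> p dvd n"
    then have "n mod p \<in> {1..<p}" using p1 by (auto simp: mod_greater_zero_iff_not_dvd Suc_le_eq)
    then show False using n by (metis cong_mod_right cong_refl)
  qed
  then obtain c where c: "n = p * c" by blast
  have "D \<le> p * q" using D_le assms(3) by (meson le_trans mult_le_mono1)
  then have "n * q < 2 * p * q"
    using size_mset_mono[OF Z(1)] Z(4) V(2) D_pos by linarith
  then have "c < 2" using p1 q_pos by (simp add: c)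
  then have "n = p" using Z(3) c by (cases c) auto
  then show ?thesis
    using Z V(1) subset_mset.order_trans has_zero_sumI by blast
qed

text \<open>If fewer than b values occurred, all of them could be avoided, giving a new one. It is
  below p because \<open>size U\<close> < p q, so it is itself among the values counted.\<close>

lemma card_zero_sum_lengths:
  assumes "seq_over G U" "b * q + D - 1 \<le> size U" "size U < p * q"
  shows "b \<le> card {n \<in> {1..<p}. has_zero_sum U (n * q)}"
proof (rule ccontr)
  let ?B = "{n \<in> {1..<p}. has_zero_sum U (n * q)}"
  assume "\<not> ?thesis"
  then have "Suc (card ?B) * q \<le> b * q" by (intro mult_le_mono1) simp
  then have "D + (q - 1) + card ?B * q \<le> size U"
    using assms(2) q_pos D_pos by simp
  then obtain Z n where Z: "Z \<subseteq># U" "zero_sum G Z" "0 < n" "size Z = n * q"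
    and n: "\<forall>b\<in>?B. [n \<noteq> b] (mod p)"
    using assms(1) by (elim exists_length_avoiding[rotated]) auto
  have "n * q < p * q" using size_mset_mono[OF Z(1)] Z(4) assms(3) by linarith
  then have "n \<in> ?B" using Z q_pos by (auto intro: has_zero_sumI)
  then show False using n cong_refl by blast
qed

section \<open>Existence of zero-sum subsequences of length k q for k \<ge> p + d\<close>

lemma has_zero_sum_prime_add:
  assumes S: "seq_over G S" "(p + t) * q + D - 1 \<le> size S"
    and t: "d \<le> t" "2 * t \<le> p + 1" "t + d \<le> p"
  shows "has_zero_sum S ((p + t) * q)"
proof (rule ccontr)
  assume no: "\<not> ?thesis"
  have p1: "p > 0" and dp: "d \<le> p" using p t(3) by (auto simp: prime_gt_0_nat)
  obtain S' where S': "S' \<subseteq># S" "size S' = (p + t) * q + D - 1"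
    using submset_of_size[OF S(2)] by blast
  then have over': "seq_over G S'" using S(1) seq_over_subset by blast
  have no': "\<not> has_zero_sum S' ((p + t) * q)" using no S'(1) has_zero_sum_mono by blast
  have no_t: "\<not> has_zero_sum S' (t * q)"
  proof
    assume "has_zero_sum S' (t * q)"
    then obtain Z where Z: "Z \<subseteq># S'" "size Z = t * q" "zero_sum G Z"
      by (auto simp: has_zero_sum_def)
    have "has_zero_sum (S' - Z) (p * q)"
      by (rule has_zero_sum_prime)
        (use S' Z over' dp in \<open>auto simp: size_Diff_submset add_mult_distrib intro: seq_over_subset\<close>)
    moreover have "has_zero_sum Z (t * q)" using Z by (intro has_zero_sumI[of Z]) auto
    ultimately have "has_zero_sum (S' - Z + Z) (p * q + t * q)"
      by (rule has_zero_sum_union[rotated]) (use over' Z(1) in simp)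
    then show False using no' Z(1) by (simp add: add_mult_distrib)
  qed
  have "has_zero_sum S' (p * q)"
    by (rule has_zero_sum_prime[OF over' _ dp]) (simp add: S'(2) add_mult_distrib)
  then obtain T where T: "T \<subseteq># S'" "size T = p * q" "zero_sum G T"
    by (auto simp: has_zero_sum_def)
  define R where "R = S' - T"
  have R: "size R = t * q + D - 1" and S'_eq: "S' = T + R"
    using T S'(2) D_pos by (auto simp: R_def size_Diff_submset add_mult_distrib)
  have over_T: "seq_over G T" and over_R: "seq_over G R"
    using over' T(1) seq_over_subset unfolding R_def by (blast, meson diff_subset_eq_self seq_over_subset)
  define NR where "NR = {n \<in> {1..<p}. has_zero_sum R (n * q)}"
  define NT where "NT = {n \<in> {1..<p}. has_zero_sum T (n * q)}"
  \<comment> \<open>The missing values below t. The contradiction will be t \<le>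
    \<open>card NR\<close> \<le> 2 \<open>card A\<close> \<le> p - 1 - \<open>card NT\<close> \<le>
    d - 1.\<close>
  define A where "A = {1..<t} - NT"
  have R_less: "size R < (t + d) * q"
    using R D_le D_pos by (simp add: add_mult_distrib)
  also have "(t + d) * q \<le> p * q" using t(3) by (rule mult_le_mono1)
  finally have "t \<le> card NR"
    unfolding NR_def by (intro card_zero_sum_lengths[OF over_R]) (simp_all add: R)
  moreover have "NR \<subseteq> (\<lambda>x. t - x) ` A \<union> (\<lambda>x. t + x) ` A"
  proof
    fix n assume "n \<in> NR"
    then have n: "n > 0" "n < p" "has_zero_sum R (n * q)" by (auto simp: NR_def)
    then have "n * q \<le> size R" by (auto simp: has_zero_sum_def dest: size_mset_mono)
    then have "n * q < (t + d) * q" using R_less by (rule le_less_trans)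
    then have n_less: "n < t + d" by simp
    have "n \<noteq> t" using n(3) no_t has_zero_sum_mono[of R _ S'] S'_eq by auto
    show "n \<in> (\<lambda>x. t - x) ` A \<union> (\<lambda>x. t + x) ` A"
    proof (cases "n < t")
      case True
      \<comment> \<open>Otherwise pieces of T and R join to length t q.\<close>
      have "t - n \<notin> NT"
      proof
        assume "t - n \<in> NT"
        then have "has_zero_sum (T + R) ((t - n) * q + n * q)"
          using n(3) over' S'_eq by (intro has_zero_sum_union) (auto simp: NT_def)
        then show False using no_t True S'_eq by (simp flip: add_mult_distrib)
      qed
      then have "t - n \<in> A" using n True by (auto simp: A_def)
      then show ?thesis using True by (intro UnI1 image_eqI[of _ _ "t - n"]) auto
    next
      case False
      then have gt: "n > t" using \<open>n \<noteq> t\<close> by simp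
      \<comment> \<open>Otherwise the complement in T, of length (p - (n - t)) q, and a piece of R
        join to length (p + t) q.\<close>
      have "n - t \<notin> NT"
      proof
        assume "n - t \<in> NT"
        then have "has_zero_sum T (size T - (n - t) * q)"
          by (intro has_zero_sum_complement over_T T) (auto simp: NT_def)
        then have "has_zero_sum (T + R) ((p * q - (n - t) * q) + n * q)"
          using n(3) over' S'_eq T(2) by (intro has_zero_sum_union) auto
        moreover have "(p * q - (n - t) * q) + n * q = (p + t) * q"
        proof -
          have "p - (n - t) + n = p + t" using gt n(2) by simp
          then show ?thesis by (simp flip: add_mult_distrib diff_mult_distrib)
        qed
        ultimately show False using no' S'_eq by simp
      qed
      \<comment> \<open>Here n - t < d \<le> t.\<close>
      then have "n - t \<in> A" using gt n_less t(1) by (auto simp: A_def)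
      then show ?thesis using gt by (intro UnI2 image_eqI[of _ _ "n - t"]) auto
    qed
  qed
  moreover have finA: "finite A" by (simp add: A_def)
  ultimately have "t \<le> card ((\<lambda>x. t - x) ` A \<union> (\<lambda>x. t + x) ` A)"
    by (meson card_mono finite_UnI finite_imageI le_trans)
  also have "\<dots> \<le> 2 * card A"
    using card_Un_le[of "(\<lambda>x. t - x) ` A" "(\<lambda>x. t + x) ` A"]
      card_image_le[OF finA, of "\<lambda>x. t - x"] card_image_le[OF finA, of "\<lambda>x. t + x"] by linarith
  also have "2 * card A = card (A \<union> (\<lambda>x. p - x) ` A)"
  proof -
    have "inj_on (\<lambda>x. p - x) A" using t by (auto simp: inj_on_def A_def)
    \<comment> \<open>Two elements of A add up to at most 2 t - 2 < p.\<close>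
    moreover have "A \<inter> (\<lambda>x. p - x) ` A = {}" using t(2) by (auto simp: A_def)
    ultimately show ?thesis using finA by (simp add: card_Un_disjoint card_image)
  qed
  also have "\<dots> \<le> card ({1..<p} - NT)"
  proof (rule card_mono)
    show "A \<union> (\<lambda>x. p - x) ` A \<subseteq> {1..<p} - NT"
    proof (intro Un_least subsetI)
      fix x assume "x \<in> A"
      then show "x \<in> {1..<p} - NT" using t(2) by (auto simp: A_def)
    next
      fix y assume "y \<in> (\<lambda>x. p - x) ` A"
      then obtain x where x: "x \<in> A" "y = p - x" by blast
      then have x_less: "0 < x" "x < p" using t(2) by (auto simp: A_def)
      have "y \<notin> NT"
      proof
        assume "y \<in> NT"
        then have "has_zero_sum T (size T - y * q)"
          by (intro has_zero_sum_complement over_T T) (auto simp: NT_def)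
        then have "x \<in> NT"
          using x(2) x_less T(2) by (auto simp: NT_def simp flip: diff_mult_distrib)
        then show False using x(1) by (simp add: A_def)
      qed
      then show "y \<in> {1..<p} - NT" using x(2) x_less by auto
    qed
  qed simp
  also have "\<dots> = p - 1 - card NT"
    by (subst card_Diff_subset) (auto simp: NT_def)
  also have "\<dots> \<le> d - 1"
  proof -
    \<comment> \<open>One term of T is dropped because the counting lemma wants length below p q;
      what is left still has at least (p - d) q + D - 1 terms.\<close>
    have "p * q - 1 \<le> size T" using T(2) by simp
    then obtain T' where T': "T' \<subseteq># T" "size T' = p * q - 1"
      using submset_of_size by blast
    have "(p - d) * q + d * q = p * q"
      using dp by (metis add_mult_distrib le_add_diff_inverse2)
    then have "p - d \<le> card {n \<in> {1..<p}. has_zero_sum T' (n * q)}"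
      using T' p1 q_pos D_le D_pos seq_over_subset[OF over_T]
      by (intro card_zero_sum_lengths) auto
    also have "\<dots> \<le> card NT"
      using T'(1) has_zero_sum_mono by (intro card_mono) (auto simp: NT_def)
    finally show ?thesis by simp
  qed
  finally show False using t(1) d_pos by simp
qed

text \<open>A short zero-sum piece lowers k by at most d, so from k \<ge> p + 2 d the descent stays
  at or above p + d and ends in the range where t = k - p satisfies d \<le> t < 2 d.\<close>

lemma has_zero_sum_of_le:
  assumes dp: "4 * d \<le> p + 4"
  shows "p + d \<le> k \<Longrightarrow> seq_over G S \<Longrightarrow> k * q + D - 1 \<le> size S \<Longrightarrow> has_zero_sum S (k * q)"
proof (induction k arbitrary: S rule: less_induct)
  case (less k)
  show ?case
  proof (cases "k < p + 2 * d")
    case True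
    \<comment> \<open>Parity gains the missing unit: 4 d \<le> p + 3 yields 2 t \<le> 4 d - 2 \<le>
      p + 1. It also yields t + d \<le> 3 d - 1 \<le> p for d \<ge> 2; for d = 1 this is p \<ge>
      2.\<close>
    have "p \<noteq> 4 * (d - 1)"
    proof
      assume "p = 4 * (d - 1)"
      then have "p = 2" using p by (metis dvd_triv_left even_numeral dvd_mult2 primes_dvd_imp_eq two_is_prime_nat)
      then show False using \<open>p = 4 * (d - 1)\<close> by simp
    qed
    then have "4 * d \<le> p + 3" using dp d_pos by linarith
    moreover have "p \<ge> 2" using p by (rule prime_ge_2_nat)
    ultimately have "has_zero_sum S ((p + (k - p)) * q)"
      using less.prems True d_pos by (intro has_zero_sum_prime_add) auto
    then show ?thesis using less.prems(1) by simp
  next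
    case False
    have "q \<le> k * q" using False d_pos by simp
    then have "D + (q - 1) \<le> size S" using less.prems(3) q_pos D_pos by linarith
    then obtain n where n: "0 < n" "n \<le> d" "has_zero_sum S (n * q)"
      using has_zero_sum_short[OF less.prems(2)] by blast
    then obtain Z where Z: "Z \<subseteq># S" "size Z = n * q" "zero_sum G Z"
      by (auto simp: has_zero_sum_def)
    have "n \<le> k" using False n(2) by linarith
    then have "(k - n) * q + n * q = k * q" by (simp flip: add_mult_distrib)
    then have k: "size S - n * q \<ge> (k - n) * q + D - 1" and eq: "(k - n) * q + n * q = k * q"
      using less.prems(3) D_pos by linarith+
    have "has_zero_sum (S - Z) ((k - n) * q)"
    proof (rule less.IH)
      show "k - n < k" using n False d_pos by simp
      show "p + d \<le> k - n" using n False by simp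
      show "seq_over G (S - Z)" using less.prems(2) diff_subset_eq_self seq_over_subset by blast
      show "(k - n) * q + D - 1 \<le> size (S - Z)" using k Z by (simp add: size_Diff_submset)
    qed
    moreover have "has_zero_sum Z (n * q)" using Z by (intro has_zero_sumI[of Z]) auto
    ultimately have "has_zero_sum (S - Z + Z) ((k - n) * q + n * q)"
      by (rule has_zero_sum_union[rotated]) (use less.prems(2) Z(1) in simp)
    then show ?thesis using Z(1) eq by simp
  qed
qed

section \<open>The extremal sequence and the value of \<open>s_const\<close>\<close>

lemma no_zero_sum_of_less:
  assumes "k > 0"
  shows "\<exists>S. seq_over G S \<and> size S = k * q + D - 2 \<and> \<not> has_zero_sum S (k * q)"
proof -
  obtain F where F: "zero_sum_free F" "D = Suc (size F)"
    using davenport_p_group(2)[OF p fin ord] by (auto simp: D_def)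
  have kq: "k * q > 0" using assms q_pos by simp
  \<comment> \<open>Added to the zero-sum free F of length D - 1, one copy of \<one> too few: a
    zero-sum subsequence takes nothing from F, so its length is at most k q - 1.\<close>
  let ?O = "replicate_mset (k * q - 1) \<one>"
  have O: "seq_over G ?O" by (auto simp: seq_over_def split: if_splits)
  have over_F: "seq_over G F" using F(1) by (simp add: zero_sum_free_def)
  have "\<not> has_zero_sum (?O + F) (k * q)"
  proof
    assume "has_zero_sum (?O + F) (k * q)"
    then obtain Z where Z: "Z \<subseteq># ?O + F" "size Z = k * q" "zero_sum G Z"
      by (auto simp: has_zero_sum_def)
    define Y where "Y = Z - ?O"
    have Y: "Y \<subseteq># F" unfolding Y_def using Z(1) by (simp add: subset_eq_diff_conv add.commute)
    have "M - (M - N) \<subseteq># N" for M N :: "'a multiset"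
      by (rule mset_subset_eqI) (auto simp: le_diff_conv)
    then have "Z - Y \<subseteq># ?O" unfolding Y_def .
    then obtain n where n: "Z - Y = replicate_mset n \<one>" "n \<le> k * q - 1"
      by (metis msubseteq_replicate_msetE)
    have "Y \<subseteq># Z" by (simp add: Y_def)
    then have Z_eq: "Z = replicate_mset n \<one> + Y" using n(1) by (metis subset_mset.diff_add)
    have "seq_over G Y" using over_F Y seq_over_subset by blast
    then have "zero_sum G Y"
      using Z(3) unfolding Z_eq zero_sum_def
      by (subst (asm) seq_sum_union) (auto simp: seq_sum_replicate seq_over_def split: if_splits)
    then have "Y = {#}" using F(1) Y by (simp add: zero_sum_free_def)
    then have "n = k * q" using Z(2) Z_eq by simp
    then show False using n(2) kq by linarith
  qed
  moreover have "seq_over G (?O + F)" using O over_F by (auto simp: seq_over_def)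
  moreover have "size (?O + F) = k * q + D - 2" using F(2) kq by simp
  ultimately show ?thesis by blast
qed

lemma s_const_eq:
  assumes "4 * d \<le> p + 4" "p + d \<le> k"
  shows "s_const (k * q) G = enat (k * q + D - 1)"
proof -
  let ?L = "{enat l | l. 0 < l \<and>
    (\<forall>S. seq_over G S \<and> l \<le> size S \<longrightarrow> (\<exists>T. T \<subseteq># S \<and> size T = k * q \<and> zero_sum G T))}"
  have k: "k > 0" using assms(2) d_pos by simp
  then have kq: "k * q > 0" using q_pos by simp
  have "k * q + D - 1 > 0" using kq D_pos by linarith
  then have "enat (k * q + D - 1) \<in> ?L"
    using has_zero_sum_of_le[OF assms] unfolding has_zero_sum_def by blast
  moreover have "enat (k * q + D - 1) \<le> x" if x: "x \<in> ?L" for x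
  proof -
    obtain l where l: "x = enat l"
      "\<And>S. seq_over G S \<Longrightarrow> l \<le> size S \<Longrightarrow> has_zero_sum S (k * q)"
      using x by (auto simp: has_zero_sum_def)
    obtain S where S: "seq_over G S" "size S = k * q + D - 2" "\<not> has_zero_sum S (k * q)"
      using no_zero_sum_of_less[OF k] by blast
    then have "\<not> l \<le> k * q + D - 2" using l(2)[of S] by auto
    then have "k * q + D - 1 \<le> l" by linarith
    then show ?thesis by (simp add: l(1))
  qed
  ultimately show ?thesis
    unfolding s_const_def by (intro antisym Inf_lower Inf_greatest)
qed

end

section \<open>The exponent as a power of p, and the bound for \<open>ell\<close>\<close>

lemma (in comm_group) group_exp_prime_power:
  assumes "prime p" "finite (carrier G)" "order G = p ^ m"
  shows "\<exists>e. group_exp G = p ^ e"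
proof -
  have "group_exp G \<in> group.ord G ` carrier G"
    unfolding group_exp_def using assms(2) by (intro Max_in) auto
  then obtain g where "g \<in> carrier G" "group_exp G = ord g" by blast
  then have "group_exp G dvd p ^ m" using ord_dvd_group_order assms(3) by metis
  then show ?thesis using assms(1) by (auto simp: divides_primepow_nat)
qed

theorem corollary6:
  fixes G :: "('a, 'b) monoid_scheme" and p q d :: nat
  assumes "prime p"
    and "comm_group G" and "finite (carrier G)"
    and "\<exists>m. order G = p ^ m"
    and "group_exp G = q"
    and "\<lceil>real (davenport G) / real q\<rceil> = int d"
    and "int p \<ge> 2 * int d - 2 + \<lceil>(2 * real (davenport G) - 2) / real q\<rceil>"
  shows "ell G \<le> enat (p + d) \<and>
    (\<forall>k\<ge>p + d. s_const (k * q) G = enat (k * q + davenport G - 1))"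
proof -
  interpret comm_group G by fact
  obtain m where m: "order G = p ^ m" using assms(4) by blast
  obtain e where e: "q = p ^ e"
    using group_exp_prime_power[OF assms(1,3) m] assms(5) by blast
  have q: "q > 0" using assms(1) e by (simp add: prime_gt_0_nat)
  have "real (davenport G) / real q \<le> real d"
    using assms(6) by (metis le_of_int_ceiling of_int_of_nat_eq)
  then have "real (davenport G) \<le> real (d * q)" using q by (simp add: field_simps)
  then have D_le: "davenport G \<le> d * q" by (simp only: of_nat_le_iff)
  interpret p_group_davenport G p m e "p ^ e" "davenport G" d
    by unfold_locales (use assms m D_le e in auto)
  \<comment> \<open>By integrality (d - 1) q < D(G) improves to (d - 1) q \<le> D(G) - 1. Hence the
    ceiling in the hypothesis is at least 2 d - 2, and p \<ge> 4 d - 4.\<close>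
  have "real d - 1 < real (davenport G) / real q"
    using assms(6) by linarith
  then have "(real d - 1) * real q < real (davenport G)" using q by (simp add: field_simps)
  then have "real_of_int ((int d - 1) * int q) < real_of_int (int (davenport G))" by simp
  then have "(int d - 1) * int q \<le> int (davenport G) - 1" by linarith
  then have "real_of_int ((int d - 1) * int q) \<le> real_of_int (int (davenport G) - 1)"
    by (simp only: of_int_le_iff)
  then have "2 * real d - 2 \<le> (2 * real (davenport G) - 2) / real q"
    using q by (simp add: field_simps)
  then have "2 * int d - 2 \<le> \<lceil>(2 * real (davenport G) - 2) / real q\<rceil>" by linarith
  then have "4 * d \<le> p + 4" using assms(7) by linarith
  then have s: "s_const (k * q) G = enat (k * q + davenport G - 1)" if "k \<ge> p + d" for k
    using s_const_eq[of k] that e by simp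
  then have "ell G \<le> enat (p + d)"
    unfolding ell_def assms(5) using prime_gt_0_nat[OF assms(1)] by (intro Inf_lower) auto
  then show ?thesis using s by blast
qed

end
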